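(* Let $\Gamma$ be a residually finite infinite amenable group that admits an oriented closed connected manifold as model of the classifying space $K(\Gamma,1)$. Then $\operatorname{rg}\Gamma = 0$.
   Context: For a finitely generated group $G$, let $d(G)$ denote the minimal size of a generating set of $G$. The absolute rank gradient of a finitely generated group $\Gamma$ is $$\operatorname{rg}\Gamma := \inf_{H\in F(\Gamma)} \frac{d(H)-1}{[\Gamma:H]},$$ where $F(\Gamma)$ denotes the set of all finite index subgroups of $\Gamma$. (A group $\Gamma$ as in the claim is the fundamental group of a closed manifold, hence finitely generated.) *)

theory Defs
  imports "HOL-Algebra.Generated_Groups" "HOL-Homology.Homology"
begin

section \<open>Finite index subgroups, generators and rank gradient\<close>

definition finite_index_subgroups :: "('a, 'b) monoid_scheme \<Rightarrow> 'a set set" where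
  "finite_index_subgroups G = {H. subgroup H G \<and> finite (rcosets\<^bsub>G\<^esub> H)}"

definition group_index :: "('a, 'b) monoid_scheme \<Rightarrow> 'a set \<Rightarrow> nat" where
  "group_index G H = card (rcosets\<^bsub>G\<^esub> H)"

text \<open>Only meaningful for finitely generated groups; for other groups the \<open>LEAST\<close> ranges over
  the empty set and the value is unspecified.\<close>
definition min_generators :: "('a, 'b) monoid_scheme \<Rightarrow> nat" where
  "min_generators G =
     (LEAST n. \<exists>S. S \<subseteq> carrier G \<and> finite S \<and> card S = n \<and> generate G S = carrier G)"

definition rank_gradient :: "('a, 'b) monoid_scheme \<Rightarrow> real" where
  "rank_gradient G =
     (INF H \<in> finite_index_subgroups G.
        (real (min_generators (G\<lparr>carrier := H\<rparr>)) - 1) / real (group_index G H))"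

definition residually_finite :: "('a, 'b) monoid_scheme \<Rightarrow> bool" where
  "residually_finite G \<longleftrightarrow>
     (\<forall>g \<in> carrier G - {\<one>\<^bsub>G\<^esub>}. \<exists>N. N \<lhd> G \<and> N \<in> finite_index_subgroups G \<and> g \<notin> N)"


section \<open>Amenability\<close>

definition bounded_fun_on :: "'a set \<Rightarrow> ('a \<Rightarrow> real) \<Rightarrow> bool" where
  "bounded_fun_on A f \<longleftrightarrow> bounded (f ` A)"

text \<open>A left invariant mean on the bounded real functions on \<open>G\<close>. Functions are total on the
  ambient type, but by linearity and positivity \<open>m f\<close> depends only on the values of \<open>f\<close>
  on \<open>carrier G\<close>; \<open>m\<close> is unconstrained on functions that are unbounded there.\<close>
definition invariant_mean :: "('a, 'b) monoid_scheme \<Rightarrow> (('a \<Rightarrow> real) \<Rightarrow> real) \<Rightarrow> bool" where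
  "invariant_mean G m \<longleftrightarrow>
     (\<forall>f g. bounded_fun_on (carrier G) f \<longrightarrow> bounded_fun_on (carrier G) g \<longrightarrow>
        m (\<lambda>x. f x + g x) = m f + m g) \<and>
     (\<forall>c f. bounded_fun_on (carrier G) f \<longrightarrow> m (\<lambda>x. c * f x) = c * m f) \<and>
     (\<forall>f. bounded_fun_on (carrier G) f \<longrightarrow> (\<forall>x \<in> carrier G. 0 \<le> f x) \<longrightarrow> 0 \<le> m f) \<and>
     m (\<lambda>_. 1) = 1 \<and>
     (\<forall>g \<in> carrier G. \<forall>f. bounded_fun_on (carrier G) f \<longrightarrow>
        m (\<lambda>x. f (g \<otimes>\<^bsub>G\<^esub> x)) = m f)"

definition amenable :: "('a, 'b) monoid_scheme \<Rightarrow> bool" where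
  "amenable G \<longleftrightarrow> (\<exists>m. invariant_mean G m)"


section \<open>Oriented closed connected manifolds\<close>

definition second_countable_space :: "'x topology \<Rightarrow> bool" where
  "second_countable_space X \<longleftrightarrow>
     (\<exists>\<B>. countable \<B> \<and> (\<forall>V \<in> \<B>. openin X V) \<and>
        (\<forall>U x. openin X U \<and> x \<in> U \<longrightarrow> (\<exists>V \<in> \<B>. x \<in> V \<and> V \<subseteq> U)))"

definition locally_euclidean :: "nat \<Rightarrow> 'x topology \<Rightarrow> bool" where
  "locally_euclidean n X \<longleftrightarrow>
     (\<forall>x \<in> topspace X. \<exists>U V. openin X U \<and> x \<in> U \<and> openin (Euclidean_space n) V \<and>
        subtopology X U homeomorphic_space subtopology (Euclidean_space n) V)"

text \<open>Topological manifolds, without boundary.\<close>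
definition manifold :: "nat \<Rightarrow> 'x topology \<Rightarrow> bool" where
  "manifold n X \<longleftrightarrow> Hausdorff_space X \<and> second_countable_space X \<and> locally_euclidean n X"

text \<open>An orientation selects a generator of each local homology group
  \<open>H\<^sub>n(X, X - {x}; \<int>)\<close> in a locally consistent way: near each point, the selected generators
  are the restrictions of a single class in \<open>H\<^sub>n(X, X - U; \<int>)\<close>.\<close>
definition orientation :: "nat \<Rightarrow> 'x topology \<Rightarrow> ('x \<Rightarrow> 'x chain set) \<Rightarrow> bool" where
  "orientation n X ori \<longleftrightarrow>
     (\<forall>x \<in> topspace X.
        ori x \<in> carrier (relative_homology_group (int n) X (topspace X - {x})) \<and>
        generate (relative_homology_group (int n) X (topspace X - {x})) {ori x} =
          carrier (relative_homology_group (int n) X (topspace X - {x}))) \<and>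
     (\<forall>x \<in> topspace X. \<exists>U \<alpha>. openin X U \<and> x \<in> U \<and>
        \<alpha> \<in> carrier (relative_homology_group (int n) X (topspace X - U)) \<and>
        (\<forall>y \<in> U. hom_induced (int n) X (topspace X - U) X (topspace X - {y}) id \<alpha> = ori y))"

definition oriented_closed_connected_manifold ::
    "nat \<Rightarrow> 'x topology \<Rightarrow> ('x \<Rightarrow> 'x chain set) \<Rightarrow> bool" where
  "oriented_closed_connected_manifold n X ori \<longleftrightarrow>
     manifold n X \<and> compact_space X \<and> connected_space X \<and> orientation n X ori"


section \<open>Homotopy groups and classifying spaces\<close>

definition loops :: "'x topology \<Rightarrow> 'x \<Rightarrow> (real \<Rightarrow> 'x) set" where
  "loops X x = {p. pathin X p \<and> p 0 = x \<and> p 1 = x}"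

definition loop_homotopy :: "'x topology \<Rightarrow> 'x \<Rightarrow> ((real \<Rightarrow> 'x) \<times> (real \<Rightarrow> 'x)) set" where
  "loop_homotopy X x = {(p, q). p \<in> loops X x \<and> q \<in> loops X x \<and>
     homotopic_with (\<lambda>r. r 0 = x \<and> r 1 = x) (top_of_set {0..1}) X p q}"

text \<open>The library's \<open>joinpaths\<close> requires a \<open>topological_space\<close> type class instance.\<close>
definition loop_concat :: "(real \<Rightarrow> 'x) \<Rightarrow> (real \<Rightarrow> 'x) \<Rightarrow> real \<Rightarrow> 'x" where
  "loop_concat p q = (\<lambda>t. if t \<le> 1/2 then p (2 * t) else q (2 * t - 1))"

definition fundamental_group :: "'x topology \<Rightarrow> 'x \<Rightarrow> (real \<Rightarrow> 'x) set monoid" where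
  "fundamental_group X x =
     \<lparr>carrier = loops X x // loop_homotopy X x,
      monoid.mult = (\<lambda>A B. \<Union>p \<in> A. \<Union>q \<in> B. loop_homotopy X x `` {loop_concat p q}),
      one = loop_homotopy X x `` {\<lambda>_. x}\<rparr>"

definition sphere_basepoint :: "nat \<Rightarrow> real" where
  "sphere_basepoint = (\<lambda>i. if i = 0 then 1 else 0)"

definition pointed_sphere_maps :: "nat \<Rightarrow> 'x topology \<Rightarrow> 'x \<Rightarrow> ((nat \<Rightarrow> real) \<Rightarrow> 'x) set" where
  "pointed_sphere_maps k X x = {f. continuous_map (nsphere k) X f \<and> f sphere_basepoint = x}"

definition pointed_homotopy ::
    "nat \<Rightarrow> 'x topology \<Rightarrow> 'x \<Rightarrow> (((nat \<Rightarrow> real) \<Rightarrow> 'x) \<times> ((nat \<Rightarrow> real) \<Rightarrow> 'x)) set" where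
  "pointed_homotopy k X x =
     {(f, g). f \<in> pointed_sphere_maps k X x \<and> g \<in> pointed_sphere_maps k X x \<and>
        homotopic_with (\<lambda>h. h sphere_basepoint = x) (nsphere k) X f g}"

text \<open>The underlying set of \<open>\<pi>\<^sub>k(X, x)\<close>, as pointed homotopy classes of maps from the
  \<open>k\<close>-sphere; the group structure plays no role for its vanishing.\<close>
definition homotopy_set :: "nat \<Rightarrow> 'x topology \<Rightarrow> 'x \<Rightarrow> ((nat \<Rightarrow> real) \<Rightarrow> 'x) set set" where
  "homotopy_set k X x = pointed_sphere_maps k X x // pointed_homotopy k X x"

text \<open>\<open>X\<close> is a \<open>K(G, 1)\<close>. As \<open>X\<close> is path connected, the choice of base point is immaterial.\<close>
definition is_K_G_1 :: "('a, 'b) monoid_scheme \<Rightarrow> 'x topology \<Rightarrow> bool" where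
  "is_K_G_1 G X \<longleftrightarrow> path_connected_space X \<and>
     (\<exists>x \<in> topspace X. G \<cong> fundamental_group X x \<and>
        (\<forall>k \<ge> 2. homotopy_set k X x = {pointed_homotopy k X x `` {\<lambda>_. x}}))"

end

theory Submission
  imports Defs "HOL-Analysis.Abstract_Topological_Spaces"
begin

text \<open>
  A compact manifold has a finitely generated fundamental group, so \<open>\<Gamma>\<close> is generated by a finite set
  \<open>S\<close>, which may be taken closed under inverses. By Schreier, all its finite index subgroups are finitely
  generated; being infinite, they need at least one generator, and the rank gradient is nonnegative.

  For the upper bound, let \<open>T\<close> be a transversal of a finite index subgroup \<open>N\<close>. Schreier's generators
  of \<open>N\<close> have the form \<open>t s u\<^sup>-\<^sup>1\<close> with \<open>t, u \<in> T\<close> and \<open>s \<in> S\<close>, and this element is trivial whenever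
  \<open>t s \<in> T\<close>. Hence \<open>d(N)\<close> is at most the number of pairs \<open>(t, s)\<close> with \<open>t s \<notin> T\<close>
  (\<open>generate_Schreier\<close>), and it suffices to find, for each \<open>\<epsilon> > 0\<close>, some \<open>N\<close> with a transversal for which
  there are at most \<open>\<epsilon> [\<Gamma> : N]\<close> such pairs: a transversal that is almost invariant.

  An almost invariant finite set \<open>F\<close> (a Folner set) exists by amenability: otherwise a fixed finite set
  \<open>K\<close> would at least double the size of every finite set, and Hall's marriage theorem would move two copies
  of \<open>\<Gamma>\<close> disjointly into \<open>\<Gamma>\<close> by piecewise translations, against the existence of an invariant mean
  (\<open>invariant_mean_imp_not_doubling\<close>, \<open>amenable_imp_right_Folner\<close>). Residual finiteness gives a normal
  \<open>N\<close> of finite index for which \<open>F\<close> and its neighbours embed into \<open>Q = \<Gamma>/N\<close>. Now cut \<open>Q\<close> greedily into pieces,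
  each one the uncovered part of a translate of the image of \<open>F\<close>. Averaging over all translates shows that
  every piece can be chosen so that the number of edges it cuts is at most \<open>\<epsilon>\<close> times its size
  (\<open>exists_translate_with_small_cut\<close>). Lifting each piece along the corresponding translate of \<open>F\<close>
  in \<open>\<Gamma>\<close> gives the transversal: an edge inside a piece lifts to an edge of the lift, and few
  edges run between pieces (\<open>exists_section_with_small_cut\<close>).

  Finite generation of the fundamental group is the classical covering argument. Cover the space by finitely
  many coordinate boxes, cut a loop into arcs inside the boxes, and return to the base point at each
  cut. The resulting loop only depends on the two boxes involved and on where in their intersection the cut
  lies, up to sliding the cut; shrinking the boxes makes finitely many positions suffice
  (\<open>finitely_many_loops_generate\<close>).
\<close>

section \<open>Hall's marriage theorem for infinite families of finite sets\<close>

text \<open>Rado's argument. By Zorn there is a maximal relation \<open>R\<close> of pairs that can be deleted from the family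
  without violating Hall's condition; finiteness of the sets is what makes the condition survive unions
  of chains. In the remaining family \<open>B\<close> every set is a singleton: if \<open>x \<noteq> y\<close> both lie in \<open>B i\<close>, then
  deleting either violates the condition at finite index sets \<open>J\<close> and \<open>K\<close>, and submodularity of
  cardinality turns the two violations into one for \<open>B\<close> itself.\<close>
lemma Hall_finite_sets:
  fixes A :: "'i \<Rightarrow> 'b set"
  assumes fin: "\<And>i. i \<in> I \<Longrightarrow> finite (A i)"
    and Hall: "\<And>J. \<lbrakk>J \<subseteq> I; finite J\<rbrakk> \<Longrightarrow> card J \<le> card (\<Union>(A ` J))"
  obtains f where "inj_on f I" "\<And>i. i \<in> I \<Longrightarrow> f i \<in> A i"
proof -
  define H where "H B \<longleftrightarrow> (\<forall>J. J \<subseteq> I \<longrightarrow> finite J \<longrightarrow> card J \<le> card (\<Union>(B ` J)))"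
    for B :: "'i \<Rightarrow> 'b set"
  define del where "del R i = A i - R `` {i}" for R i
  define \<R> where "\<R> = {R. H (del R)}"
  have finU: "finite (\<Union>(del R ` J))" if "J \<subseteq> I" "finite J" for R J
    using that fin by (auto simp: del_def)
  have "{} \<in> \<R>"
    using Hall by (auto simp: \<R>_def H_def del_def)
  then have ne: "\<R> \<noteq> {}" by blast
  have chain: "\<Union>\<C> \<in> \<R>" if \<C>: "\<C> \<noteq> {}" "subset.chain \<R> \<C>" for \<C>
  proof -
    have "card J \<le> card (\<Union>(del (\<Union>\<C>) ` J))" if J: "J \<subseteq> I" "finite J" for J
    proof -
      have "finite (\<Union>\<C> \<inter> Sigma J A)"
        using J fin by (intro finite_Int disjI2 finite_SigmaI) auto
      moreover have "\<Union>\<C> \<inter> Sigma J A \<subseteq> \<Union>\<C>" by blast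
      ultimately obtain R where R: "R \<in> \<C>" "\<Union>\<C> \<inter> Sigma J A \<subseteq> R"
        using finite_subset_Union_chain[OF _ _ \<C>] by metis
      have "\<Union>(del (\<Union>\<C>) ` J) = \<Union>(del R ` J)"
        using R by (fastforce simp: del_def)
      moreover have "R \<in> \<R>"
        using R \<C> by (auto simp: subset.chain_def)
      ultimately show ?thesis
        using J by (simp add: \<R>_def H_def)
    qed
    then show ?thesis by (simp add: \<R>_def H_def)
  qed
  from subset_Zorn_nonempty[OF ne chain]
  obtain R where R: "R \<in> \<R>" and max: "\<And>R'. \<lbrakk>R' \<in> \<R>; R \<subseteq> R'\<rbrakk> \<Longrightarrow> R' = R"
    by blast
  define B where "B = del R"
  have BA: "B i \<subseteq> A i" for i by (auto simp: B_def del_def)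
  have HB: "card J \<le> card (\<Union>(B ` J))" if "J \<subseteq> I" "finite J" for J
    using R that by (simp add: \<R>_def H_def B_def)
  \<comment> \<open>The index set of a violation contains \<open>i\<close>; the witness \<open>J\<close> here is that set without \<open>i\<close>.\<close>
  have violate: "\<exists>J. J \<subseteq> I \<and> finite J \<and> i \<notin> J \<and> card (\<Union>(B ` J) \<union> (B i - {x})) \<le> card J"
    if i: "i \<in> I" and x: "x \<in> B i" for i x
  proof -
    have "(i,x) \<notin> R" using x by (auto simp: B_def del_def)
    then have "insert (i,x) R \<notin> \<R>" using max[of "insert (i,x) R"] by blast
    then obtain J where J: "J \<subseteq> I" "finite J"
      and less: "card (\<Union>(del (insert (i,x) R) ` J)) < card J"
      by (auto simp: \<R>_def H_def not_le)
    have other: "del (insert (i,x) R) j = B j" if "j \<noteq> i" for j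
      using that by (auto simp: B_def del_def)
    have self: "del (insert (i,x) R) i = B i - {x}"
      by (auto simp: B_def del_def)
    have "i \<in> J"
    proof (rule ccontr)
      assume "i \<notin> J"
      then have "\<Union>(del (insert (i,x) R) ` J) = \<Union>(B ` J)"
        using other by (metis (no_types, lifting) image_cong)
      then show False using less HB[OF J] by simp
    qed
    then have "J = insert i (J - {i})" by blast
    then have "\<Union>(del (insert (i,x) R) ` J) = (B i - {x}) \<union> \<Union>(del (insert (i,x) R) ` (J - {i}))"
      using self by (metis (no_types, lifting) UN_insert)
    also have "\<Union>(del (insert (i,x) R) ` (J - {i})) = \<Union>(B ` (J - {i}))"
      using other by (metis (no_types, lifting) image_cong DiffE singletonI)
    finally have "\<Union>(del (insert (i,x) R) ` J) = \<Union>(B ` (J - {i})) \<union> (B i - {x})"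
      by blast
    then show ?thesis
      using J less \<open>i \<in> J\<close> by (intro exI[of _ "J - {i}"]) auto
  qed
  have unique: "x = y" if i: "i \<in> I" and xy: "x \<in> B i" "y \<in> B i" for i x y
  proof (rule ccontr)
    assume "x \<noteq> y"
    obtain J where J: "J \<subseteq> I" "finite J" "i \<notin> J" "card (\<Union>(B ` J) \<union> (B i - {x})) \<le> card J"
      using violate[OF i xy(1)] by blast
    obtain K where K: "K \<subseteq> I" "finite K" "i \<notin> K" "card (\<Union>(B ` K) \<union> (B i - {y})) \<le> card K"
      using violate[OF i xy(2)] by blast
    define X where "X = \<Union>(B ` J) \<union> (B i - {x})"
    define Y where "Y = \<Union>(B ` K) \<union> (B i - {y})"
    have fB: "finite (B j)" if "j \<in> I" for j
      using that fin BA finite_subset by metis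
    have fXY: "finite X" "finite Y"
      using J K fB i by (auto simp: X_def Y_def)
    have "card J + card K + 1 = card (insert i (J \<union> K)) + card (J \<inter> K)"
      using J K by (simp add: card_Un_Int[of J K])
    also have "\<dots> \<le> card (\<Union>(B ` insert i (J \<union> K))) + card (\<Union>(B ` (J \<inter> K)))"
      using J K i by (intro add_mono HB) auto
    also have "\<dots> \<le> card (X \<union> Y) + card (X \<inter> Y)"
      using fXY \<open>x \<noteq> y\<close> by (intro add_mono card_mono) (auto simp: X_def Y_def)
    also have "\<dots> = card X + card Y"
      using card_Un_Int[OF fXY] by simp
    also have "\<dots> \<le> card J + card K"
      using J K by (simp add: X_def Y_def)
    finally show False by simp
  qed
  have ex: "\<exists>x. x \<in> B i" if "i \<in> I" for i
    using HB[of "{i}"] that by (auto simp: Suc_le_eq card_gt_0_iff)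
  define f where "f i = (SOME x. x \<in> B i)" for i
  have f: "f i \<in> B i" if "i \<in> I" for i
    unfolding f_def using ex[OF that] by (rule someI_ex)
  have Bf: "B i = {f i}" if "i \<in> I" for i
    using f unique that by blast
  have "inj_on f I"
  proof (rule inj_onI, rule ccontr)
    fix i j assume ij: "i \<in> I" "j \<in> I" "f i = f j" "i \<noteq> j"
    then have "card {i,j} \<le> card (B i \<union> B j)" using HB[of "{i,j}"] by simp
    then show False using ij Bf by simp
  qed
  then show thesis using f BA that by blast
qed

section \<open>Invariant means and Folner sets\<close>

lemma bounded_fun_on_iff: "bounded_fun_on A f \<longleftrightarrow> (\<exists>B. \<forall>x\<in>A. \<bar>f x\<bar> \<le> B)"
  by (simp add: bounded_fun_on_def bounded_iff)

lemma bounded_fun_on_add: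
  "\<lbrakk>bounded_fun_on A f; bounded_fun_on A g\<rbrakk> \<Longrightarrow> bounded_fun_on A (\<lambda>x. f x + g x)"
  unfolding bounded_fun_on_iff by (meson abs_triangle_ineq add_mono order_trans)

lemma bounded_fun_on_cmult: "bounded_fun_on A f \<Longrightarrow> bounded_fun_on A (\<lambda>x. c * f x)"
  unfolding bounded_fun_on_iff abs_mult by (meson abs_ge_zero mult_left_mono)

lemma bounded_fun_on_const [simp]: "bounded_fun_on A (\<lambda>_. c)"
  unfolding bounded_fun_on_iff by blast

lemma bounded_fun_on_sum:
  "(\<And>i. i \<in> I \<Longrightarrow> bounded_fun_on A (f i)) \<Longrightarrow> bounded_fun_on A (\<lambda>x. \<Sum>i\<in>I. f i x)"
  by (induction I rule: infinite_finite_induct) (simp_all add: bounded_fun_on_add)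

context
  fixes G :: "('a, 'b) monoid_scheme" and m
  assumes mean: "invariant_mean G m"
begin

lemma mean_add:
  "\<lbrakk>bounded_fun_on (carrier G) f; bounded_fun_on (carrier G) g\<rbrakk> \<Longrightarrow> m (\<lambda>x. f x + g x) = m f + m g"
  using mean by (simp add: invariant_mean_def)

lemma mean_cmult: "bounded_fun_on (carrier G) f \<Longrightarrow> m (\<lambda>x. c * f x) = c * m f"
  using mean by (simp add: invariant_mean_def)

lemma mean_one: "m (\<lambda>_. 1) = 1"
  using mean by (simp add: invariant_mean_def)

lemma mean_translate:
  "\<lbrakk>g \<in> carrier G; bounded_fun_on (carrier G) f\<rbrakk> \<Longrightarrow> m (\<lambda>x. f (g \<otimes>\<^bsub>G\<^esub> x)) = m f"
  using mean by (simp add: invariant_mean_def)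

lemma mean_mono:
  assumes "bounded_fun_on (carrier G) f" "bounded_fun_on (carrier G) g"
    and "\<And>x. x \<in> carrier G \<Longrightarrow> f x \<le> g x"
  shows "m f \<le> m g"
proof -
  have b: "bounded_fun_on (carrier G) (\<lambda>x. (-1) * f x)"
    using assms by (intro bounded_fun_on_cmult)
  then have b': "bounded_fun_on (carrier G) (\<lambda>x. g x + (-1) * f x)"
    using assms by (intro bounded_fun_on_add)
  have "\<forall>x\<in>carrier G. 0 \<le> g x + (-1) * f x"
    using assms by simp
  with b' have "0 \<le> m (\<lambda>x. g x + (-1) * f x)"
    using mean unfolding invariant_mean_def by blast
  also have "\<dots> = m g + (-1) * m f"
    using assms b mean_add[of g "\<lambda>x. (-1) * f x"] mean_cmult[of f "-1"] by simp
  finally show ?thesis by simp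
qed

text \<open>The invariant mean is applied to functions on the whole type; its value depends on the carrier only.\<close>
lemma mean_cong:
  assumes "bounded_fun_on (carrier G) f" "bounded_fun_on (carrier G) g"
    and "\<And>x. x \<in> carrier G \<Longrightarrow> f x = g x"
  shows "m f = m g"
  using assms by (intro antisym mean_mono) auto

lemma mean_sum:
  assumes "\<And>i. i \<in> I \<Longrightarrow> bounded_fun_on (carrier G) (f i)"
  shows "m (\<lambda>x. \<Sum>i\<in>I. f i x) = (\<Sum>i\<in>I. m (f i))"
proof -
  have zero: "m (\<lambda>_. 0) = 0"
    using mean_cmult[of "\<lambda>_. 1" 0] by simp
  show ?thesis
    using assms
    by (induction I rule: infinite_finite_induct)
       (simp_all add: zero mean_add bounded_fun_on_sum)
qed

end

context group begin

text \<open>Doubling is Hall's condition for the sets \<open>K x\<close>, each taken twice. An injective choice \<open>f\<close> from them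
  moves two copies of the group into the group by piecewise left translation: \<open>a k i\<close> is the indicator of
  the part of copy \<open>i\<close> on which \<open>f\<close> multiplies by \<open>k\<close>. The parts of each copy add up to the constant
  \<open>1\<close>, so all parts together have mean \<open>2\<close>. Their translates are disjoint, so they have mean at most
  \<open>1\<close>, although translation preserves the mean.\<close>
lemma invariant_mean_imp_not_doubling:
  assumes mean: "invariant_mean G m" and K: "finite K" "K \<subseteq> carrier G"
    and doubling: "\<And>F. \<lbrakk>finite F; F \<subseteq> carrier G\<rbrakk> \<Longrightarrow> 2 * card F \<le> card (K <#> F)"
  shows False
proof -
  let ?I = "carrier G \<times> (UNIV :: bool set)"
  define A where "A p = (\<lambda>k. k \<otimes> fst p) ` K" for p :: "'a \<times> bool"
  have finA: "finite (A p)" for p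
    using K by (simp add: A_def)
  have Hall: "card J \<le> card (\<Union>(A ` J))" if J: "J \<subseteq> ?I" "finite J" for J
  proof -
    have "card J \<le> card (fst ` J \<times> (UNIV :: bool set))"
      using J by (intro card_mono) (auto intro: rev_image_eqI)
    also have "\<dots> = 2 * card (fst ` J)"
      by (simp add: card_cartesian_product)
    also have "\<dots> \<le> card (K <#> (fst ` J))"
      using J by (intro doubling) auto
    also have "K <#> (fst ` J) = \<Union>(A ` J)"
      by (auto simp: A_def set_mult_def)
    finally show ?thesis .
  qed
  obtain f where inj: "inj_on f ?I" and fA: "\<And>p. p \<in> ?I \<Longrightarrow> f p \<in> A p"
    using Hall_finite_sets[of ?I A] finA Hall by metis
  define a where "a k i x = (of_bool (f (x,i) = k \<otimes> x) :: real)" for k i x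
  have ba [simp]: "bounded_fun_on (carrier G) (a k i)" for k i
    unfolding bounded_fun_on_iff by (rule exI[of _ 1]) (auto simp: a_def)
  have ba' [simp]: "bounded_fun_on (carrier G) (\<lambda>x. a k i (h x))" for k i h
    unfolding bounded_fun_on_iff by (rule exI[of _ 1]) (auto simp: a_def)
  have ma: "m (a k i) = m (\<lambda>x. a k i (inv k \<otimes> x))" if "k \<in> K" for k i
    using that K mean_translate[OF mean, of "inv k" "a k i"] by auto
  have one: "(\<Sum>k\<in>K. a k i x) = 1" if x: "x \<in> carrier G" for i x
  proof -
    obtain k0 where k0: "k0 \<in> K" "f (x,i) = k0 \<otimes> x"
      using fA[of "(x,i)"] x by (auto simp: A_def)
    have "a k i x = of_bool (k = k0)" if "k \<in> K" for k
      using k0 K x that by (auto simp: a_def subset_iff)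
    then have "(\<Sum>k\<in>K. a k i x) = (\<Sum>k\<in>K. of_bool (k = k0))"
      by (intro sum.cong) auto
    also have "\<dots> = 1"
      using K k0 by (simp add: of_bool_def)
    finally show ?thesis .
  qed
  \<comment> \<open>The pairs contributing at \<open>x\<close> are those whose translated part contains \<open>x\<close>; injectivity of \<open>f\<close> leaves at most one.\<close>
  have le1: "(\<Sum>(k,i)\<in>K \<times> UNIV. a k i (inv k \<otimes> x)) \<le> 1" if x: "x \<in> carrier G" for x
  proof -
    define P where "P = {(k,i) \<in> K \<times> UNIV. f (inv k \<otimes> x, i) = k \<otimes> (inv k \<otimes> x)}"
    have kx: "k \<otimes> (inv k \<otimes> x) = x" if "k \<in> K" for k
      using that K x by (simp add: subset_iff flip: m_assoc)
    have "p = q" if "p \<in> P" "q \<in> P" for p q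
    proof -
      obtain k i l j where pq: "p = (k,i)" "q = (l,j)" by fastforce
      have kl: "k \<in> K" "l \<in> K" "k \<in> carrier G" "l \<in> carrier G"
        using that K pq by (auto simp: P_def)
      have "f (inv k \<otimes> x, i) = f (inv l \<otimes> x, j)"
        using that kx kl pq by (auto simp: P_def)
      then have "(inv k \<otimes> x, i) = (inv l \<otimes> x, j)"
        using inj kl x by (intro inj_onD[OF inj]) auto
      then have "inv k = inv l" "i = j"
        using kl x by auto
      then show ?thesis
        using kl pq inj_onD[OF inv_inj, of k l] by simp
    qed
    then have "card P \<le> 1"
      by (cases "finite P") (simp_all add: card_le_Suc0_iff_eq)
    moreover have "(\<Sum>(k,i)\<in>K \<times> UNIV. a k i (inv k \<otimes> x)) = real (card P)"
    proof -
      have "(\<Sum>(k,i)\<in>K \<times> UNIV. a k i (inv k \<otimes> x)) = 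
        (\<Sum>p\<in>K \<times> UNIV. of_bool (p \<in> P))"
        by (intro sum.cong) (auto simp: a_def P_def)
      also have "\<dots> = real (card ((K \<times> UNIV) \<inter> P))"
        using K by (simp add: sum_of_bool_eq)
      also have "(K \<times> UNIV) \<inter> P = P" by (auto simp: P_def)
      finally show ?thesis .
    qed
    ultimately show ?thesis by simp
  qed
  have "2 = (\<Sum>i\<in>(UNIV::bool set). m (\<lambda>x. \<Sum>k\<in>K. a k i x))"
  proof -
    have "m (\<lambda>x. \<Sum>k\<in>K. a k i x) = m (\<lambda>_. 1)" for i
      using one by (intro mean_cong[OF mean] bounded_fun_on_sum) auto
    then show ?thesis
      by (simp add: mean_one[OF mean])
  qed
  also have "\<dots> = (\<Sum>i\<in>UNIV. \<Sum>k\<in>K. m (a k i))"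
    by (simp add: mean_sum[OF mean])
  also have "\<dots> = (\<Sum>i\<in>UNIV. \<Sum>k\<in>K. m (\<lambda>x. a k i (inv k \<otimes> x)))"
    using ma by simp
  also have "\<dots> = (\<Sum>(k,i)\<in>K \<times> UNIV. m (\<lambda>x. a k i (inv k \<otimes> x)))"
    by (subst sum.swap) (rule sum.cartesian_product)
  also have "\<dots> = m (\<lambda>x. \<Sum>(k,i)\<in>K \<times> UNIV. a k i (inv k \<otimes> x))"
    using mean_sum[OF mean, of "K \<times> UNIV" "\<lambda>(k,i) x. a k i (inv k \<otimes> x)"]
    by (auto simp: case_prod_unfold)
  also have "\<dots> \<le> m (\<lambda>_. 1)"
    using le1 by (intro mean_mono[OF mean] bounded_fun_on_sum) (auto simp: case_prod_unfold)
  finally show False by (simp add: mean_one[OF mean])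
qed

lemma finite_set_mult: "\<lbrakk>finite A; finite B\<rbrakk> \<Longrightarrow> finite (A <#> B)"
  by (simp add: set_mult_def)

lemma set_multI: "\<lbrakk>a \<in> A; b \<in> B\<rbrakk> \<Longrightarrow> a \<otimes> b \<in> A <#> B"
  unfolding set_mult_def by blast

text \<open>If no finite set \<open>F\<close> works, then \<open>K = S \<union> {\<one>}\<close> enlarges every finite set by a fixed factor
  \<open>1 + \<delta>\<close>, hence a power of \<open>K\<close> doubles every finite set.\<close>
lemma amenable_imp_left_Folner:
  fixes \<epsilon> :: real
  assumes am: "amenable G" and S: "finite S" "S \<subseteq> carrier G" and \<epsilon>: "\<epsilon> > 0"
  obtains F where "finite F" "F \<noteq> {}" "F \<subseteq> carrier G"
    "real (card {(s,x) \<in> S \<times> F. s \<otimes> x \<notin> F}) \<le> \<epsilon> * card F"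
proof (rule ccontr)
  note goal = that
  assume "\<not> thesis"
  then have large: "\<epsilon> * card F < card {(s,x) \<in> S \<times> F. s \<otimes> x \<notin> F}"
    if "finite F" "F \<noteq> {}" "F \<subseteq> carrier G" for F
    using that goal[of F] by linarith
  define K where "K = insert \<one> S"
  have K: "finite K" "K \<subseteq> carrier G"
    using S by (auto simp: K_def)
  define \<delta> where "\<delta> = \<epsilon> / (card S + 1)"
  have \<delta>: "\<delta> > 0" using \<epsilon> by (simp add: \<delta>_def)
  have grow: "(1 + \<delta>) * card F \<le> card (K <#> F)" if F: "finite F" "F \<subseteq> carrier G" for F
  proof (cases "F = {}")
    case False
    have finKF: "finite (K <#> F)" using K F by (simp add: finite_set_mult)
    have "F \<subseteq> K <#> F"
      using F set_multI[of \<one> K _ F] by (auto simp: K_def subset_iff)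
    have "card {(s,x) \<in> S \<times> F. s \<otimes> x \<notin> F} \<le> card (S \<times> ((K <#> F) - F))"
    proof (rule card_inj_on_le[where f = "\<lambda>(s,x). (s, s \<otimes> x)"])
      show "inj_on (\<lambda>(s, x). (s, s \<otimes> x)) {(s,x) \<in> S \<times> F. s \<otimes> x \<notin> F}"
        using S F by (auto simp: inj_on_def subset_iff)
      show "(\<lambda>(s, x). (s, s \<otimes> x)) ` {(s,x) \<in> S \<times> F. s \<otimes> x \<notin> F} \<subseteq> S \<times> ((K <#> F) - F)"
      proof (rule subsetI)
        fix p assume "p \<in> (\<lambda>(s, x). (s, s \<otimes> x)) ` {(s,x) \<in> S \<times> F. s \<otimes> x \<notin> F}"
        then obtain s x where "p = (s, s \<otimes> x)" "s \<in> S" "x \<in> F" "s \<otimes> x \<notin> F"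
          by auto
        then show "p \<in> S \<times> ((K <#> F) - F)"
          using set_multI[of s K x F] by (simp add: K_def)
      qed
      show "finite (S \<times> ((K <#> F) - F))"
        using S finKF by blast
    qed
    then have "\<epsilon> * card F < card S * real (card ((K <#> F) - F))"
      using large[OF F(1) False F(2)]
      unfolding card_cartesian_product by (simp flip: of_nat_mult)
    also have "\<dots> \<le> (card S + 1) * real (card ((K <#> F) - F))"
      by (intro mult_right_mono) auto
    finally have "\<delta> * card F \<le> card ((K <#> F) - F)"
      unfolding \<delta>_def by (simp add: divide_simps mult.commute)
    moreover have "card (K <#> F) = card F + card ((K <#> F) - F)"
      using \<open>F \<subseteq> K <#> F\<close> finKF F(1) by (simp add: card_Diff_subset card_mono)
    ultimately show ?thesis by (simp add: algebra_simps)
  qed simp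
  define Kn where "Kn n = ((\<lambda>A. K <#> A) ^^ n) {\<one>}" for n :: nat
  have Kn: "finite (Kn n) \<and> Kn n \<subseteq> carrier G" for n
    by (induction n) (use K in \<open>simp_all add: Kn_def finite_set_mult set_mult_closed\<close>)
  have growth: "(1 + \<delta>) ^ n * card F \<le> card (Kn n <#> F)"
    if F: "finite F" "F \<subseteq> carrier G" for F n
  proof (induction n)
    case 0
    have "Kn 0 <#> F = F" using F by (force simp: Kn_def set_mult_def)
    then show ?case by simp
  next
    case (Suc n)
    have sub: "Kn n <#> F \<subseteq> carrier G" "finite (Kn n <#> F)"
      using Kn[of n] F by (simp_all add: finite_set_mult set_mult_closed)
    have "(1 + \<delta>) ^ Suc n * card F \<le> (1 + \<delta>) * card (Kn n <#> F)"
      using Suc \<delta> by (simp add: mult.assoc)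
    also have "\<dots> \<le> card (K <#> (Kn n <#> F))"
      using grow sub by blast
    also have "K <#> (Kn n <#> F) = Kn (Suc n) <#> F"
      using K Kn F by (simp add: Kn_def set_mult_assoc)
    finally show ?case .
  qed
  obtain n where n: "2 < (1 + \<delta>) ^ n"
    using real_arch_pow[of "1 + \<delta>" 2] \<delta> by auto
  obtain m where "invariant_mean G m"
    using am by (auto simp: amenable_def)
  moreover have "2 * card F \<le> card (Kn n <#> F)" if F: "finite F" "F \<subseteq> carrier G" for F
  proof -
    have "2 * real (card F) \<le> (1 + \<delta>) ^ n * card F"
      using n by (intro mult_right_mono) auto
    also have "\<dots> \<le> card (Kn n <#> F)"
      by (rule growth[OF F])
    finally show ?thesis by linarith
  qed
  ultimately show False
    using invariant_mean_imp_not_doubling[of m "Kn n"] Kn by blast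
qed

text \<open>Inversion exchanges left and right multiplication.\<close>
lemma amenable_imp_right_Folner:
  fixes \<epsilon> :: real
  assumes am: "amenable G" and S: "finite S" "S \<subseteq> carrier G" and \<epsilon>: "\<epsilon> > 0"
  obtains F where "finite F" "F \<noteq> {}" "F \<subseteq> carrier G"
    "real (card {(x,s) \<in> F \<times> S. x \<otimes> s \<notin> F}) \<le> \<epsilon> * card F"
proof -
  have "finite (m_inv G ` S)" "m_inv G ` S \<subseteq> carrier G"
    using S by auto
  then obtain F where F: "finite F" "F \<noteq> {}" "F \<subseteq> carrier G"
    and bd: "real (card {(s,x) \<in> m_inv G ` S \<times> F. s \<otimes> x \<notin> F}) \<le> \<epsilon> * card F"
    using amenable_imp_left_Folner[OF am _ _ \<epsilon>, of "m_inv G ` S"] by blast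
  define F' where "F' = m_inv G ` F"
  have mem: "x \<in> F' \<longleftrightarrow> inv x \<in> F" if "x \<in> carrier G" for x
  proof
    assume "x \<in> F'"
    then obtain y where "y \<in> F" "x = inv y" by (auto simp: F'_def)
    then show "inv x \<in> F" using F by auto
  next
    assume "inv x \<in> F"
    then have "inv (inv x) \<in> F'" unfolding F'_def by (rule imageI)
    then show "x \<in> F'" using that by simp
  qed
  have F': "finite F'" "F' \<noteq> {}" "F' \<subseteq> carrier G"
    using F by (auto simp: F'_def)
  have "card F' = card F"
    unfolding F'_def using F by (intro card_image inj_on_subset[OF inv_inj])
  have "card {(x,s) \<in> F' \<times> S. x \<otimes> s \<notin> F'} \<le> card {(s,x) \<in> m_inv G ` S \<times> F. s \<otimes> x \<notin> F}"
  proof (rule card_inj_on_le[where f = "\<lambda>(x,s). (inv s, inv x)"])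
    show "inj_on (\<lambda>(x, s). (inv s, inv x)) {(x,s) \<in> F' \<times> S. x \<otimes> s \<notin> F'}"
    proof (rule inj_onI, clarify)
      fix x s y t
      assume xs: "x \<in> F'" "s \<in> S" "y \<in> F'" "t \<in> S" and eq: "inv s = inv t" "inv x = inv y"
      have "x \<in> carrier G" "s \<in> carrier G" "y \<in> carrier G" "t \<in> carrier G"
        using xs S F' by auto
      then show "x = y \<and> s = t"
        using inj_onD[OF inv_inj eq(2)] inj_onD[OF inv_inj eq(1)] by simp
    qed
    show "finite {(s,x) \<in> m_inv G ` S \<times> F. s \<otimes> x \<notin> F}"
      by (rule finite_subset[of _ "m_inv G ` S \<times> F"]) (use S F in auto)
    show "(\<lambda>(x, s). (inv s, inv x)) ` {(x,s) \<in> F' \<times> S. x \<otimes> s \<notin> F'}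
        \<subseteq> {(s,x) \<in> m_inv G ` S \<times> F. s \<otimes> x \<notin> F}"
    proof (rule subsetI)
      fix p assume "p \<in> (\<lambda>(x, s). (inv s, inv x)) ` {(x,s) \<in> F' \<times> S. x \<otimes> s \<notin> F'}"
      then obtain x s where xs: "p = (inv s, inv x)" "x \<in> F'" "s \<in> S" "x \<otimes> s \<notin> F'"
        by auto
      then have c: "x \<in> carrier G" "s \<in> carrier G" using F' S by auto
      then show "p \<in> {(s,x) \<in> m_inv G ` S \<times> F. s \<otimes> x \<notin> F}"
        using xs mem[of x] mem[of "x \<otimes> s"] by (simp add: inv_mult_group)
    qed
  qed
  then have "real (card {(x,s) \<in> F' \<times> S. x \<otimes> s \<notin> F'}) \<le> \<epsilon> * card F'"
    using bd unfolding \<open>card F' = card F\<close> by (meson of_nat_mono order_trans)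
  then show thesis using F' that by blast
qed

end

section \<open>Almost invariant sections of finite quotients\<close>

text \<open>A double count over all translates \<open>v B\<close>. Each \<open>c \<in> U\<close> lies in \<open>card B\<close> of them, so the pieces
  \<open>A v = U \<inter> v B\<close> have total size \<open>card U * card B\<close>. An edge \<open>(c, s)\<close> leaving \<open>v B\<close>
  corresponds to the pair of \<open>c\<close> and the edge \<open>(v\<^sup>-\<^sup>1 c, s)\<close> leaving \<open>B\<close>, so at most \<open>card U\<close> times
  the boundary of \<open>B\<close> are cut in total. Some nonempty piece is therefore no worse than the average.
  The edges are labelled by \<open>s\<close> rather than by \<open>a s\<close> because \<open>a\<close> will be a quotient map, which
  may identify generators.\<close>
lemma (in group) exists_translate_with_small_cut:
  assumes finG: "finite (carrier G)" and S: "finite S" "a \<in> S \<rightarrow> carrier G"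
    and B: "B \<subseteq> carrier G" "B \<noteq> {}" and U: "U \<subseteq> carrier G" "U \<noteq> {}"
  defines "A \<equiv> \<lambda>v. {c \<in> U. inv v \<otimes> c \<in> B}"
  obtains v where "v \<in> carrier G" "A v \<noteq> {}"
    "card {(c,s) \<in> A v \<times> S. c \<otimes> a s \<in> U - A v} * card B
      \<le> card {(x,s) \<in> B \<times> S. x \<otimes> a s \<notin> B} * card (A v)"
proof -
  define E where "E v = {(c,s) \<in> A v \<times> S. c \<otimes> a s \<in> U - A v}" for v
  define D where "D = {(x,s) \<in> B \<times> S. x \<otimes> a s \<notin> B}"
  have fin: "finite U" "finite B" "finite (A v)" for v
    using finite_subset[OF U(1) finG] finite_subset[OF B(1) finG] by (auto simp: A_def)
  have finE: "finite (E v)" for v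
    by (rule finite_subset[of _ "A v \<times> S"]) (use fin S in \<open>auto simp: E_def\<close>)
  have finD: "finite D"
    by (rule finite_subset[of _ "B \<times> S"]) (use fin S in \<open>auto simp: D_def\<close>)
  have "(\<Sum>v\<in>carrier G. card (A v)) = card (SIGMA v:carrier G. A v)"
    using finG fin by simp
  also have "\<dots> = card (U \<times> B)"
  proof (rule bij_betw_same_card[of "\<lambda>(v,c). (c, inv v \<otimes> c)"],
         rule bij_betw_byWitness[where f' = "\<lambda>(c,x). (c \<otimes> inv x, c)"])
    show "\<forall>p\<in>SIGMA v:carrier G. A v. (\<lambda>(c,x). (c \<otimes> inv x, c)) ((\<lambda>(v,c). (c, inv v \<otimes> c)) p) = p"
      using U by (auto simp: A_def inv_mult_group subset_iff simp flip: m_assoc)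
    show "\<forall>p\<in>U \<times> B. (\<lambda>(v,c). (c, inv v \<otimes> c)) ((\<lambda>(c,x). (c \<otimes> inv x, c)) p) = p"
      using U B by (auto simp: inv_mult_group subset_iff m_assoc)
    show "(\<lambda>(v,c). (c, inv v \<otimes> c)) ` (SIGMA v:carrier G. A v) \<subseteq> U \<times> B"
      by (auto simp: A_def)
    show "(\<lambda>(c,x). (c \<otimes> inv x, c)) ` (U \<times> B) \<subseteq> (SIGMA v:carrier G. A v)"
      using U B by (auto simp: A_def inv_mult_group subset_iff m_assoc)
  qed
  finally have sumA: "(\<Sum>v\<in>carrier G. card (A v)) = card U * card B"
    by (simp add: card_cartesian_product)
  have "(\<Sum>v\<in>carrier G. card (E v)) = card (SIGMA v:carrier G. E v)"
    using finG finE by simp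
  also have "\<dots> \<le> card (U \<times> D)"
  proof (rule card_inj_on_le[where f = "\<lambda>(v,c,s). (c, inv v \<otimes> c, s)"])
    show "inj_on (\<lambda>(v,c,s). (c, inv v \<otimes> c, s)) (SIGMA v:carrier G. E v)"
    proof (rule inj_onI)
      fix p q
      assume pq: "p \<in> (SIGMA v:carrier G. E v)" "q \<in> (SIGMA v:carrier G. E v)"
        and eq: "(\<lambda>(v,c,s). (c, inv v \<otimes> c, s)) p = (\<lambda>(v,c,s). (c, inv v \<otimes> c, s)) q"
      obtain v c s w d t where p: "p = (v,c,s)" "q = (w,d,t)"
        by (metis prod.collapse)
      have c: "v \<in> carrier G" "w \<in> carrier G" "c \<in> carrier G"
        using pq p U by (auto simp: E_def A_def)
      moreover have "d = c" "t = s" "inv v \<otimes> c = inv w \<otimes> c"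
        using eq p by auto
      ultimately show "p = q"
        using p inj_onD[OF inv_inj, of v w] by simp
    qed
    show "(\<lambda>(v,c,s). (c, inv v \<otimes> c, s)) ` (SIGMA v:carrier G. E v) \<subseteq> U \<times> D"
    proof (rule subsetI)
      fix p assume "p \<in> (\<lambda>(v,c,s). (c, inv v \<otimes> c, s)) ` (SIGMA v:carrier G. E v)"
      then obtain v c s where p: "p = (c, inv v \<otimes> c, s)" "v \<in> carrier G" "c \<in> A v" "s \<in> S"
        "c \<otimes> a s \<in> U - A v"
        by (auto simp: E_def)
      then have "c \<in> carrier G" "a s \<in> carrier G" using U S by (auto simp: A_def)
      then show "p \<in> U \<times> D"
        using p by (auto simp: D_def A_def m_assoc)
    qed
    show "finite (U \<times> D)" using fin finD by blast
  qed
  finally have sumE: "(\<Sum>v\<in>carrier G. card (E v)) \<le> card U * card D"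
    by (simp add: card_cartesian_product)
  have "\<exists>v\<in>carrier G. A v \<noteq> {} \<and> card (E v) * card B \<le> card D * card (A v)"
  proof (rule ccontr)
    assume "\<not> ?thesis"
    then have no: "card D * card (A v) < card (E v) * card B"
      if "v \<in> carrier G" "A v \<noteq> {}" for v
      using that by (meson not_le)
    then have le: "card D * card (A v) \<le> card (E v) * card B" if "v \<in> carrier G" for v
      using that by (cases "A v = {}") (auto intro: less_imp_le)
    have "0 < (\<Sum>v\<in>carrier G. card (A v))"
      unfolding sumA using fin U B by (simp add: card_gt_0_iff)
    then obtain v where v: "v \<in> carrier G" "A v \<noteq> {}"
      by (metis card.empty less_irrefl sum.neutral)
    have "card D * (card U * card B) = (\<Sum>v\<in>carrier G. card D * card (A v))"
      by (simp add: sumA flip: sum_distrib_left)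
    also have "\<dots> < (\<Sum>v\<in>carrier G. card (E v) * card B)"
      using finG le no v by (intro sum_strict_mono_ex1) blast+
    also have "\<dots> \<le> (card U * card D) * card B"
      using sumE by (simp flip: sum_distrib_right)
    finally show False by (simp add: mult_ac)
  qed
  then show thesis
    using that unfolding E_def D_def by blast
qed

text \<open>The greedy tiling. Induction on \<open>card U\<close>: remove from \<open>U\<close> a piece \<open>A\<close> with small cut, contained in a
  translate \<open>v (h ` F)\<close>, and lift it to the corresponding part \<open>TA\<close> of \<open>w F\<close>, where \<open>h w = v\<close>. An edge
  inside \<open>A\<close> lifts to an edge of \<open>TA\<close>, because \<open>h\<close> is faithful on \<open>F\<close> and its neighbours. The new
  bad edges thus run between \<open>A\<close> and \<open>U - A\<close>. Reversing an edge, which is possible as \<open>S\<close> is closed under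
  inverses, shows that either direction contributes at most \<open>\<epsilon> * card A\<close>; this is the factor \<open>2\<close>.\<close>
lemma (in group_hom) exists_section_with_small_cut:
  fixes \<epsilon> :: real
  assumes finH: "finite (carrier H)" and surj: "h ` carrier G = carrier H"
    and S: "finite S" "S \<subseteq> carrier G" and sym: "\<And>s. s \<in> S \<Longrightarrow> inv s \<in> S"
    and F: "finite F" "F \<noteq> {}" "F \<subseteq> carrier G"
    and bd: "real (card {(x,s) \<in> F \<times> S. x \<otimes> s \<notin> F}) \<le> \<epsilon> * card F"
    and inj: "\<And>x s y. \<lbrakk>x \<in> F; s \<in> insert \<one> S; y \<in> F; h (x \<otimes> s) = h y\<rbrakk> \<Longrightarrow> x \<otimes> s = y"
  shows "U \<subseteq> carrier H \<Longrightarrow> \<exists>T \<subseteq> carrier G. bij_betw h T U \<and>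
    real (card {(t,s) \<in> T \<times> S. h (t \<otimes> s) \<in> U \<and> t \<otimes> s \<notin> T}) \<le> 2 * \<epsilon> * card U"
proof (induction "card U" arbitrary: U rule: less_induct)
  case less
  show ?case
  proof (cases "U = {}")
    case True
    then show ?thesis by (intro exI[of _ "{}"]) (auto simp: bij_betw_def)
  next
    case False
    define B where "B = h ` F"
    have B: "B \<subseteq> carrier H" "B \<noteq> {}"
      using F by (auto simp: B_def)
    have injF: "inj_on h F"
    proof (rule inj_onI)
      fix x y assume "x \<in> F" "y \<in> F" "h x = h y"
      then show "x = y" using inj[of x \<one> y] F by auto
    qed
    have hS: "h \<in> S \<rightarrow> carrier H" using S by auto
    obtain v where v: "v \<in> carrier H" and ne: "{c \<in> U. inv\<^bsub>H\<^esub> v \<otimes>\<^bsub>H\<^esub> c \<in> B} \<noteq> {}"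
      and cut: "card {(c,s) \<in> {c \<in> U. inv\<^bsub>H\<^esub> v \<otimes>\<^bsub>H\<^esub> c \<in> B} \<times> S. 
            c \<otimes>\<^bsub>H\<^esub> h s \<in> U - {c \<in> U. inv\<^bsub>H\<^esub> v \<otimes>\<^bsub>H\<^esub> c \<in> B}} * card B
        \<le> card {(x,s) \<in> B \<times> S. x \<otimes>\<^bsub>H\<^esub> h s \<notin> B} * card {c \<in> U. inv\<^bsub>H\<^esub> v \<otimes>\<^bsub>H\<^esub> c \<in> B}"
      using H.exists_translate_with_small_cut[OF finH S(1) hS B less.prems False] by blast
    define A where "A = {c \<in> U. inv\<^bsub>H\<^esub> v \<otimes>\<^bsub>H\<^esub> c \<in> B}"
    define E where "E = {(c,s) \<in> A \<times> S. c \<otimes>\<^bsub>H\<^esub> h s \<in> U - A}"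
    have finU: "finite U" using less.prems finH finite_subset by blast
    have A: "A \<subseteq> U" "A \<noteq> {}" "finite A"
      using ne finU by (auto simp: A_def)
    have finE: "finite E"
      by (rule finite_subset[of _ "A \<times> S"]) (use A S in \<open>auto simp: E_def\<close>)
    have cutA: "real (card E) \<le> \<epsilon> * card A"
    proof -
      have "card {(x,s) \<in> B \<times> S. x \<otimes>\<^bsub>H\<^esub> h s \<notin> B} \<le> card {(x,s) \<in> F \<times> S. x \<otimes> s \<notin> F}"
      proof (rule surj_card_le[where f = "\<lambda>(x,s). (h x, s)"])
        show "finite {(x,s) \<in> F \<times> S. x \<otimes> s \<notin> F}"
          by (rule finite_subset[of _ "F \<times> S"]) (use F S in auto)
        show "{(x,s) \<in> B \<times> S. x \<otimes>\<^bsub>H\<^esub> h s \<notin> B} \<subseteq> (\<lambda>(x,s). (h x, s)) ` {(x,s) \<in> F \<times> S. x \<otimes> s \<notin> F}"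
        proof (rule subsetI)
          fix p assume "p \<in> {(x,s) \<in> B \<times> S. x \<otimes>\<^bsub>H\<^esub> h s \<notin> B}"
          then obtain x s where p: "p = (h x, s)" "x \<in> F" "s \<in> S" "h x \<otimes>\<^bsub>H\<^esub> h s \<notin> B"
            by (auto simp: B_def)
          then have "h (x \<otimes> s) \<notin> h ` F" using F S by (auto simp: B_def subset_iff)
          then have "(x,s) \<in> {(x,s) \<in> F \<times> S. x \<otimes> s \<notin> F}" using p by auto
          then show "p \<in> (\<lambda>(x,s). (h x, s)) ` {(x,s) \<in> F \<times> S. x \<otimes> s \<notin> F}"
            using p(1) by force
        qed
      qed
      then have "real (card {(x,s) \<in> B \<times> S. x \<otimes>\<^bsub>H\<^esub> h s \<notin> B}) \<le> \<epsilon> * card F"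
        using bd by (meson of_nat_mono order_trans)
      then have "real (card {(x,s) \<in> B \<times> S. x \<otimes>\<^bsub>H\<^esub> h s \<notin> B}) * card A \<le> \<epsilon> * card F * card A"
        by (rule mult_right_mono) simp
      moreover have "real (card E) * card B \<le> real (card {(x,s) \<in> B \<times> S. x \<otimes>\<^bsub>H\<^esub> h s \<notin> B}) * card A"
        using of_nat_mono[OF cut, where 'a = real] by (simp add: E_def A_def)
      moreover have "card B = card F"
        unfolding B_def by (rule card_image[OF injF])
      ultimately have "real (card E) * card F \<le> (\<epsilon> * card A) * card F"
        by (simp add: mult_ac)
      moreover have "0 < card F" using F by (simp add: card_gt_0_iff)
      ultimately show ?thesis by simp
    qed
    have "card (U - A) < card U"
      using A finU by (intro psubset_card_mono) auto
    moreover have "U - A \<subseteq> carrier H" using less.prems by blast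
    ultimately obtain T' where T': "T' \<subseteq> carrier G" "bij_betw h T' (U - A)"
      and bad': "real (card {(t,s) \<in> T' \<times> S. h (t \<otimes> s) \<in> U - A \<and> t \<otimes> s \<notin> T'}) \<le> 2 * \<epsilon> * card (U - A)"
      using less.hyps by blast
    obtain w where w: "w \<in> carrier G" "h w = v"
      using v surj by (metis imageE)
    define TA where "TA = {w \<otimes> x |x. x \<in> F \<and> h (w \<otimes> x) \<in> U}"
    have hwx: "inv\<^bsub>H\<^esub> v \<otimes>\<^bsub>H\<^esub> h (w \<otimes> g) = h g" if "g \<in> carrier G" for g
      using that w v by (simp flip: H.m_assoc)
    have TA: "TA \<subseteq> carrier G" using F w by (auto simp: TA_def)
    have hTA: "h ` TA = A"
    proof
      show "h ` TA \<subseteq> A"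
        using hwx F by (auto simp: TA_def A_def B_def)
      show "A \<subseteq> h ` TA"
      proof
        fix c assume c: "c \<in> A"
        then obtain x where x: "x \<in> F" "inv\<^bsub>H\<^esub> v \<otimes>\<^bsub>H\<^esub> c = h x" and "c \<in> U"
          by (auto simp: A_def B_def)
        have cH: "c \<in> carrier H" using \<open>c \<in> U\<close> less.prems by auto
        have "h (w \<otimes> x) = v \<otimes>\<^bsub>H\<^esub> (inv\<^bsub>H\<^esub> v \<otimes>\<^bsub>H\<^esub> c)"
          using x F w by auto
        also have "\<dots> = c" using v cH by (simp flip: H.m_assoc)
        finally have "h (w \<otimes> x) = c" .
        then have "w \<otimes> x \<in> TA" using x \<open>c \<in> U\<close> by (auto simp: TA_def)
        then show "c \<in> h ` TA" using \<open>h (w \<otimes> x) = c\<close> by blast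
      qed
    qed
    have injTA: "inj_on h TA"
    proof (rule inj_onI)
      fix t u assume tu: "t \<in> TA" "u \<in> TA" "h t = h u"
      then obtain x y where xy: "t = w \<otimes> x" "u = w \<otimes> y" "x \<in> F" "y \<in> F"
        by (auto simp: TA_def)
      then have "x \<in> carrier G" "y \<in> carrier G" using F by auto
      then have "h x = h y" using tu(3) xy hwx[of x] hwx[of y] by simp
      then show "t = u" using xy inj_onD[OF injF] by auto
    qed
    define T where "T = T' \<union> TA"
    have T: "T \<subseteq> carrier G" using T' TA by (simp add: T_def)
    have bij: "bij_betw h T U"
    proof -
      have "bij_betw h TA A" using injTA hTA by (simp add: bij_betw_def)
      then have "bij_betw h (T' \<union> TA) ((U - A) \<union> A)"
        using T'(2) by (intro bij_betw_combine) auto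
      moreover have "(U - A) \<union> A = U" using A by blast
      ultimately show ?thesis by (simp add: T_def)
    qed
    have hT': "h t \<in> U - A" if "t \<in> T'" for t
      using that T'(2) by (auto simp: bij_betw_def)
    have finT: "finite T" "finite T'" "finite TA"
      using bij finU bij_betw_finite unfolding T_def by (metis finite_Un)+
    \<comment> \<open>Bad edges inside \<open>U - A\<close>, out of \<open>A\<close>, and into \<open>A\<close>.\<close>
    define X1 where "X1 = {(t,s) \<in> T' \<times> S. h (t \<otimes> s) \<in> U - A \<and> t \<otimes> s \<notin> T'}"
    define X2 where "X2 = {(t,s) \<in> TA \<times> S. h (t \<otimes> s) \<in> U - A}"
    define X3 where "X3 = {(t,s) \<in> T' \<times> S. h (t \<otimes> s) \<in> A}"
    have finX: "finite X1" "finite X2" "finite X3"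
      by (rule finite_subset[of _ "T \<times> S"], use finT S in \<open>auto simp: X1_def X2_def X3_def T_def\<close>)+
    have "{(t,s) \<in> T \<times> S. h (t \<otimes> s) \<in> U \<and> t \<otimes> s \<notin> T} \<subseteq> X1 \<union> X2 \<union> X3"
    proof (rule subsetI)
      fix p assume "p \<in> {(t,s) \<in> T \<times> S. h (t \<otimes> s) \<in> U \<and> t \<otimes> s \<notin> T}"
      then obtain t s where p: "p = (t,s)" "t \<in> T" "s \<in> S" "h (t \<otimes> s) \<in> U" "t \<otimes> s \<notin> T"
        by auto
      show "p \<in> X1 \<union> X2 \<union> X3"
      proof (cases "t \<in> TA \<and> h (t \<otimes> s) \<in> A")
        case True
        then obtain x where x: "t = w \<otimes> x" "x \<in> F"
          by (auto simp: TA_def)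
        have c: "x \<in> carrier G" "s \<in> carrier G" using x p F S by auto
        then have ts: "t \<otimes> s = w \<otimes> (x \<otimes> s)" using x w by (simp add: G.m_assoc)
        then have "h (x \<otimes> s) \<in> h ` F"
          using True hwx[of "x \<otimes> s"] c by (simp add: A_def B_def)
        then obtain y where "y \<in> F" "h (x \<otimes> s) = h y" by auto
        then have "x \<otimes> s \<in> F" using inj[of x s y] x p by simp
        then have "t \<otimes> s \<in> TA" using ts p(4) unfolding TA_def by auto
        then show ?thesis using p by (simp add: T_def)
      next
        case False
        then show ?thesis using p by (auto simp: X1_def X2_def X3_def T_def)
      qed
    qed
    then have "card {(t,s) \<in> T \<times> S. h (t \<otimes> s) \<in> U \<and> t \<otimes> s \<notin> T} \<le> card (X1 \<union> X2 \<union> X3)"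
      using finX by (intro card_mono) auto
    also have "\<dots> \<le> card X1 + card X2 + card X3"
      by (meson add_mono card_Un_le order_refl order_trans)
    also have "\<dots> \<le> card X1 + card E + card E"
    proof (intro add_mono order_refl)
      show "card X2 \<le> card E"
      proof (rule card_inj_on_le[OF _ _ finE, where f = "\<lambda>(t,s). (h t, s)"])
        show "inj_on (\<lambda>(t,s). (h t, s)) X2"
          using injTA by (auto simp: inj_on_def X2_def)
        show "(\<lambda>(t,s). (h t, s)) ` X2 \<subseteq> E"
          using hTA TA S by (auto simp: E_def X2_def subset_iff)
      qed
      show "card X3 \<le> card E"
      proof (rule card_inj_on_le[OF _ _ finE, where f = "\<lambda>(t,s). (h (t \<otimes> s), inv s)"])
        have undo: "h (t \<otimes> s) \<otimes>\<^bsub>H\<^esub> h (inv s) = h t" if "t \<in> T'" "s \<in> S" for t s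
        proof -
          have c: "t \<in> carrier G" "s \<in> carrier G" using that T' S by auto
          then have "h (t \<otimes> s) \<otimes>\<^bsub>H\<^esub> h (inv s) = h (t \<otimes> s \<otimes> inv s)" by simp
          also have "t \<otimes> s \<otimes> inv s = t" using c by (simp add: G.m_assoc)
          finally show ?thesis .
        qed
        show "inj_on (\<lambda>(t,s). (h (t \<otimes> s), inv s)) X3"
        proof (rule inj_onI, clarify)
          fix t s u r
          assume "(t,s) \<in> X3" "(u,r) \<in> X3" and eq: "h (t \<otimes> s) = h (u \<otimes> r)" "inv s = inv r"
          then have m: "t \<in> T'" "s \<in> S" "u \<in> T'" "r \<in> S" by (auto simp: X3_def)
          then have "s = r" using eq(2) S inj_onD[OF G.inv_inj, of s r] by auto
          moreover have "h t = h u"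
            using undo[OF m(1,2)] undo[OF m(3,4)] eq by simp
          then have "t = u" using T'(2) m by (auto simp: bij_betw_def inj_on_def)
          ultimately show "t = u \<and> s = r" by simp
        qed
        show "(\<lambda>(t,s). (h (t \<otimes> s), inv s)) ` X3 \<subseteq> E"
        proof (rule subsetI)
          fix p assume "p \<in> (\<lambda>(t,s). (h (t \<otimes> s), inv s)) ` X3"
          then obtain t s where "p = (h (t \<otimes> s), inv s)" "t \<in> T'" "s \<in> S" "h (t \<otimes> s) \<in> A"
            by (auto simp: X3_def)
          then show "p \<in> E" using undo[of t s] hT'[of t] sym[of s] by (simp add: E_def)
        qed
      qed
    qed
    finally have "real (card {(t,s) \<in> T \<times> S. h (t \<otimes> s) \<in> U \<and> t \<otimes> s \<notin> T})
        \<le> card X1 + 2 * card E"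
      by linarith
    also have "\<dots> \<le> 2 * \<epsilon> * card (U - A) + 2 * \<epsilon> * card A"
      using bad' cutA by (simp add: X1_def)
    also have "\<dots> = 2 * \<epsilon> * (card (U - A) + card A)"
      by (simp add: algebra_simps)
    also have "card (U - A) + card A = card U"
      using A finU by (simp add: card_Diff_subset card_mono)
    finally show ?thesis using T bij by blast
  qed
qed

section \<open>Schreier generators\<close>

text \<open>For the retraction \<open>r\<close> onto the transversal, \<open>g a b = r a b (r (a b))\<^sup>-\<^sup>1\<close> lies in \<open>H\<close> and satisfies
  the cocycle identity \<open>g a (b c) = g a b g (a b) c\<close>. So if \<open>g a s\<close> lies in a subgroup for all generators
  \<open>s\<close> and all \<open>a\<close>, then so does \<open>g a b\<close> for all \<open>b\<close>, and these elements exhaust \<open>H\<close>. The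
  bound on \<open>card X\<close> comes from \<open>g t s = \<one>\<close> whenever \<open>t \<otimes> s \<in> T\<close>.\<close>
lemma (in group) generate_Schreier:
  assumes H: "subgroup H G" and S: "finite S" "S \<subseteq> carrier G" "generate G S = carrier G"
    and T: "finite T" "T \<subseteq> carrier G" "bij_betw (\<lambda>t. H #> t) T (rcosets H)"
  obtains X where "finite X" "X \<subseteq> H" "card X \<le> card {(t,s) \<in> T \<times> S. t \<otimes> s \<notin> T}"
    "generate (G\<lparr>carrier := H\<rparr>) X = H"
proof -
  interpret H: subgroup H G by (rule H)
  define r where "r a = inv_into T (\<lambda>t. H #> t) (H #> a)" for a
  have cos: "H #> a \<in> (\<lambda>t. H #> t) ` T" if "a \<in> carrier G" for a
    using rcosetsI[OF H.subset that] T(3) by (simp add: bij_betw_def)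
  have rT: "r a \<in> T" if "a \<in> carrier G" for a
    unfolding r_def by (rule inv_into_into[OF cos[OF that]])
  have rcos: "H #> r a = H #> a" if "a \<in> carrier G" for a
    unfolding r_def by (rule f_inv_into_f[OF cos[OF that]])
  have rc: "r a \<in> carrier G" if "a \<in> carrier G" for a
    using rT[OF that] T by blast
  have rt: "r t = t" if "t \<in> T" for t
    using that T(3) unfolding r_def by (auto simp: bij_betw_def)
  have rmult: "r (r a \<otimes> b) = r (a \<otimes> b)" if "a \<in> carrier G" "b \<in> carrier G" for a b
  proof -
    have "H #> (r a \<otimes> b) = (H #> r a) #> b"
      using that rc H.subset by (simp add: coset_mult_assoc)
    also have "\<dots> = H #> (a \<otimes> b)"
      using that H.subset by (simp add: rcos coset_mult_assoc)
    finally show ?thesis by (simp add: r_def)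
  qed
  define g where "g a b = r a \<otimes> b \<otimes> inv (r (a \<otimes> b))" for a b
  have gH: "g a b \<in> H" if "a \<in> carrier G" "b \<in> carrier G" for a b
  proof -
    have "H #> (r a \<otimes> b) = H #> r (a \<otimes> b)"
      using that rc rmult rcos[of "r a \<otimes> b"] by simp
    then have "r a \<otimes> b \<in> H #> r (a \<otimes> b)"
      using that rc H.subset rcos_self[OF _ H, of "r a \<otimes> b"] by simp
    then show ?thesis
      using that rc H.rcos_module[OF group_axioms, of "r (a \<otimes> b)" "r a \<otimes> b"] by (simp add: g_def)
  qed
  define X where "X = (\<lambda>(t,s). g t s) ` {(t,s) \<in> T \<times> S. t \<otimes> s \<notin> T}"
  have fin: "finite {(t,s) \<in> T \<times> S. t \<otimes> s \<notin> T}"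
    by (rule finite_subset[of _ "T \<times> S"]) (use S T in auto)
  have XH: "X \<subseteq> H"
    using gH S T by (auto simp: X_def subset_iff)
  define K where "K = generate G X"
  have Ksub: "subgroup K G"
    unfolding K_def using XH H.subset by (intro generate_is_subgroup) auto
  interpret K: subgroup K G by (rule Ksub)
  have gS: "g a s \<in> K" if "a \<in> carrier G" "s \<in> S" for a s
  proof -
    have s: "s \<in> carrier G" using that S by blast
    have "g a s = g (r a) s"
      using that s rmult rt rT by (simp add: g_def)
    also have "\<dots> \<in> K"
    proof (cases "r a \<otimes> s \<in> T")
      case True
      then have "g (r a) s = \<one>"
        using that s rc rt rT by (simp add: g_def)
      then show ?thesis by simp
    next
      case False
      then have "g (r a) s \<in> X"
        using that rT by (force simp: X_def)
      then show ?thesis unfolding K_def by (rule generate.incl)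
    qed
    finally show ?thesis .
  qed
  have gmult: "g a (b \<otimes> c) = g a b \<otimes> g (a \<otimes> b) c"
    if "a \<in> carrier G" "b \<in> carrier G" "c \<in> carrier G" for a b c
  proof -
    have "inv (r (a \<otimes> b)) \<otimes> (r (a \<otimes> b) \<otimes> z) = z" if "z \<in> carrier G" for z
      using that \<open>a \<in> carrier G\<close> \<open>b \<in> carrier G\<close> rc by (simp flip: m_assoc)
    then show ?thesis
      unfolding g_def using that rc by (simp add: m_assoc)
  qed
  have gK: "\<forall>a\<in>carrier G. g a b \<in> K" if "b \<in> generate G S" for b
    using that
  proof (induction b rule: generate.induct)
    case one
    show ?case using rc by (auto simp: g_def)
  next
    case (incl s)
    then show ?case using gS by blast
  next
    case (inv s)
    show ?case
    proof
      fix a assume a: "a \<in> carrier G"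
      have s: "s \<in> carrier G" using inv S by blast
      have "\<one> = g a (inv s \<otimes> s)"
        using a s rc by (simp add: g_def)
      also have "\<dots> = g a (inv s) \<otimes> g (a \<otimes> inv s) s"
        using a s by (intro gmult) auto
      finally have "g a (inv s) = inv (g (a \<otimes> inv s) s)"
        using a s gH[of a "inv s"] gH[of "a \<otimes> inv s" s] H.subset
        by (intro inv_equality[symmetric]) (auto simp: subset_iff)
      then show "g a (inv s) \<in> K"
        using gS[of "a \<otimes> inv s" s] a s inv by simp
    qed
  next
    case (eng b c)
    have "b \<in> carrier G" "c \<in> carrier G" using eng.hyps S by auto
    then show ?case using eng.IH by (auto simp: gmult)
  qed
  have "H \<subseteq> K"
  proof
    fix x assume x: "x \<in> H"
    define e where "e = r \<one>"
    have e: "e \<in> H"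
    proof -
      have "e \<in> H #> e" using rc H.subset rcos_self[OF _ H, of e] by (simp add: e_def)
      also have "H #> e = H" using rcos[of \<one>] H.subset by (simp add: e_def coset_mult_one)
      finally show ?thesis .
    qed
    \<comment> \<open>The transversal need not contain \<open>\<one>\<close>: the representative \<open>e\<close> of \<open>H\<close> conjugates the value \<open>g \<one> y\<close>.\<close>
    define y where "y = inv e \<otimes> x \<otimes> e"
    have y: "y \<in> H" using e x by (simp add: y_def)
    have c: "e \<in> carrier G" "x \<in> carrier G" "y \<in> carrier G" using e x y by auto
    have "H #> y = H #> \<one>" using y H.subset by (simp add: coset_join2 H)
    then have "r y = e" by (simp add: e_def r_def)
    then have "g \<one> y = e \<otimes> (inv e \<otimes> x \<otimes> e) \<otimes> inv e"
      using c by (simp add: g_def e_def[symmetric] y_def[symmetric])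
    also have "\<dots> = e \<otimes> (inv e \<otimes> x)"
      using c by (simp add: m_assoc)
    also have "\<dots> = x" using c by (simp flip: m_assoc)
    finally show "x \<in> K" using gK[of y] S(3) c by auto
  qed
  moreover have "K \<subseteq> H"
    unfolding K_def using XH H by (rule generate_subgroup_incl)
  ultimately have "generate (G\<lparr>carrier := H\<rparr>) X = H"
    unfolding generate_consistent[OF XH H] K_def by simp
  moreover have "finite X" "card X \<le> card {(t,s) \<in> T \<times> S. t \<otimes> s \<notin> T}"
    unfolding X_def using fin by (auto intro: card_image_le)
  ultimately show thesis using XH that by blast
qed


section \<open>Finite index subgroups\<close>

lemma (in group) carrier_mem_finite_index_subgroups: "carrier G \<in> finite_index_subgroups G"
proof -
  have "rcosets (carrier G) \<subseteq> {carrier G}"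
    by (auto simp: RCOSETS_def coset_join2 subgroup_self)
  then show ?thesis
    by (auto simp: finite_index_subgroups_def subgroup_self intro: finite_subset)
qed

lemma (in group) Int_mem_finite_index_subgroups:
  assumes "H \<in> finite_index_subgroups G" "K \<in> finite_index_subgroups G"
  shows "H \<inter> K \<in> finite_index_subgroups G"
proof -
  have H: "subgroup H G" "finite (rcosets H)" and K: "subgroup K G" "finite (rcosets K)"
    using assms by (auto simp: finite_index_subgroups_def)
  have "(H \<inter> K) #> a = (H #> a) \<inter> (K #> a)" if "a \<in> carrier G" for a
  proof
    show "(H #> a) \<inter> (K #> a) \<subseteq> (H \<inter> K) #> a"
    proof
      fix x assume "x \<in> (H #> a) \<inter> (K #> a)"
      then obtain h k where hk: "h \<in> H" "k \<in> K" "x = h \<otimes> a" "x = k \<otimes> a"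
        by (auto simp: r_coset_def)
      then have "h = k"
        using that subgroup.mem_carrier[OF H(1)] subgroup.mem_carrier[OF K(1)] by simp
      then show "x \<in> (H \<inter> K) #> a" using hk by (auto simp: r_coset_def)
    qed
  qed (auto simp: r_coset_def)
  then have "rcosets (H \<inter> K) \<subseteq> (\<lambda>(A,B). A \<inter> B) ` ((rcosets H) \<times> (rcosets K))"
    by (fastforce simp: RCOSETS_def)
  then have "finite (rcosets (H \<inter> K))"
    using H K by (meson finite_SigmaI finite_imageI finite_subset)
  then show ?thesis
    using H K by (simp add: finite_index_subgroups_def subgroups_Inter_pair)
qed

lemma (in group) residually_finite_avoid_finite:
  assumes rf: "residually_finite G" and E: "finite E" "E \<subseteq> carrier G - {\<one>}"
  obtains N where "N \<lhd> G" "N \<in> finite_index_subgroups G" "N \<inter> E = {}"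
proof -
  have "\<exists>N. N \<lhd> G \<and> N \<in> finite_index_subgroups G \<and> N \<inter> E = {}"
    using E
  proof (induction E rule: finite_induct)
    case empty
    have "carrier G \<lhd> G"
      unfolding normal_inv_iff by (simp add: subgroup_self)
    then show ?case using carrier_mem_finite_index_subgroups by auto
  next
    case (insert g E)
    then obtain N where N: "N \<lhd> G" "N \<in> finite_index_subgroups G" "N \<inter> E = {}"
      by auto
    obtain M where M: "M \<lhd> G" "M \<in> finite_index_subgroups G" "g \<notin> M"
      using rf insert.prems by (auto simp: residually_finite_def)
    show ?case
      using N M by (intro exI[of _ "N \<inter> M"])
        (auto intro: normal_subgroup_intersect Int_mem_finite_index_subgroups)
  qed
  then show thesis using that by blast
qed

section \<open>Rank gradient of amenable residually finite groups\<close>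

lemma min_generators_le:
  "\<lbrakk>finite X; X \<subseteq> carrier G; generate G X = carrier G\<rbrakk> \<Longrightarrow> min_generators G \<le> card X"
  unfolding min_generators_def by (rule Least_le) blast

text \<open>Finite generation is what gives the \<open>LEAST\<close> a meaning: some generating set attains it.\<close>
lemma (in group) min_generators_pos:
  assumes "finite X" "X \<subseteq> carrier G" "generate G X = carrier G" "carrier G \<noteq> {\<one>}"
  shows "min_generators G \<ge> 1"
proof -
  have "\<exists>S. S \<subseteq> carrier G \<and> finite S \<and> card S = min_generators G \<and> generate G S = carrier G"
    unfolding min_generators_def
    by (rule LeastI[where P = "\<lambda>n. \<exists>S. S \<subseteq> carrier G \<and> finite S \<and> card S = n \<and> generate G S = carrier G"
          and k = "card X"]) (use assms in blast)
  then obtain S where S: "finite S" "card S = min_generators G" "generate G S = carrier G"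
    by blast
  have "S \<noteq> {}"
    using S(3) assms(4) generate_empty by auto
  then show ?thesis
    using S by (simp add: Suc_le_eq card_gt_0_iff flip: S(2))
qed

lemma (in group) exists_transversal:
  assumes "subgroup H G"
  obtains T where "T \<subseteq> carrier G" "bij_betw (\<lambda>t. H #> t) T (rcosets H)"
proof -
  have "\<forall>C\<in>rcosets H. \<exists>t\<in>carrier G. H #> t = C"
    by (auto simp: RCOSETS_def)
  then obtain r where r: "\<And>C. C \<in> rcosets H \<Longrightarrow> r C \<in> carrier G \<and> H #> r C = C"
    by metis
  show thesis
  proof
    show "r ` (rcosets H) \<subseteq> carrier G" using r by auto
    show "bij_betw (\<lambda>t. H #> t) (r ` (rcosets H)) (rcosets H)"
      using r by (intro bij_betw_byWitness[where f' = r]) auto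
  qed
qed

lemma (in group) infinite_finite_index_subgroup:
  assumes inf: "infinite (carrier G)" and H: "H \<in> finite_index_subgroups G"
  shows "infinite H"
proof
  assume "finite H"
  have sub: "subgroup H G" and fin: "finite (rcosets H)"
    using H by (auto simp: finite_index_subgroups_def)
  have "finite C" if "C \<in> rcosets H" for C
    using that \<open>finite H\<close> by (auto simp: RCOSETS_def r_coset_def)
  then have "finite (\<Union>(rcosets H))" using fin by blast
  then show False using inf rcosets_part_G[OF sub] by simp
qed

lemma (in group) min_generators_finite_index_pos:
  assumes S: "finite S" "S \<subseteq> carrier G" "generate G S = carrier G"
    and inf: "infinite (carrier G)" and H: "H \<in> finite_index_subgroups G"
  shows "min_generators (G\<lparr>carrier := H\<rparr>) \<ge> 1"
proof -
  have sub: "subgroup H G" and fin: "finite (rcosets H)"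
    using H by (auto simp: finite_index_subgroups_def)
  obtain T where T: "T \<subseteq> carrier G" "bij_betw (\<lambda>t. H #> t) T (rcosets H)"
    using exists_transversal[OF sub] by blast
  then have "finite T" using fin bij_betw_finite by blast
  obtain X where X: "finite X" "X \<subseteq> H" "card X \<le> card {(t,s) \<in> T \<times> S. t \<otimes> s \<notin> T}"
    "generate (G\<lparr>carrier := H\<rparr>) X = H"
    using generate_Schreier[OF sub S \<open>finite T\<close> T] by blast
  interpret H: group "G\<lparr>carrier := H\<rparr>"
    by (rule subgroup_imp_group[OF sub])
  have "H \<noteq> {\<one>}"
    using infinite_finite_index_subgroup[OF inf H] by auto
  then show ?thesis
    using X by (intro H.min_generators_pos[of X]) simp_all
qed

text \<open>\<open>N\<close> avoids the nontrivial elements \<open>x s y\<^sup>-\<^sup>1\<close> with \<open>x, y \<in> F\<close>, so that \<open>F\<close> and its neighbours embed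
  into the quotient. The section of the quotient with few bad edges is a transversal of \<open>N\<close>, and the
  bad edges account for all its nontrivial Schreier generators.\<close>
lemma (in group) exists_finite_index_few_generators:
  fixes \<epsilon> :: real
  assumes am: "amenable G" and rf: "residually_finite G"
    and S: "finite S" "S \<subseteq> carrier G" "generate G S = carrier G" and \<epsilon>: "\<epsilon> > 0"
  obtains N where "N \<in> finite_index_subgroups G"
    "real (min_generators (G\<lparr>carrier := N\<rparr>)) \<le> \<epsilon> * real (group_index G N)"
proof -
  define S' where "S' = S \<union> m_inv G ` S"
  have S': "finite S'" "S' \<subseteq> carrier G" and sym: "\<And>s. s \<in> S' \<Longrightarrow> inv s \<in> S'"
    using S by (auto simp: S'_def)
  have genS': "generate G S' = carrier G"
    using mono_generate[of S S'] S(3) generate_incl[OF S'(2)] by (auto simp: S'_def)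
  obtain F where F: "finite F" "F \<noteq> {}" "F \<subseteq> carrier G"
    and bd: "real (card {(x,s) \<in> F \<times> S'. x \<otimes> s \<notin> F}) \<le> (\<epsilon> / 2) * card F"
    using amenable_imp_right_Folner[OF am S', of "\<epsilon> / 2"] \<epsilon> by auto
  define E where "E = (\<lambda>(x,s,y). x \<otimes> s \<otimes> inv y) ` (F \<times> insert \<one> S' \<times> F) - {\<one>}"
  have "finite E" using F S' by (simp add: E_def)
  moreover have "E \<subseteq> carrier G - {\<one>}" using F S' by (auto simp: E_def subset_iff)
  ultimately obtain N where N: "N \<lhd> G" "N \<in> finite_index_subgroups G" "N \<inter> E = {}"
    using residually_finite_avoid_finite[OF rf] by blast
  interpret N: normal N G by (rule N(1))
  have sub: "subgroup N G" and fin: "finite (rcosets N)"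
    using N(2) by (auto simp: finite_index_subgroups_def)
  let ?h = "\<lambda>a. N #> a"
  interpret h: group_hom G "G Mod N" ?h
    using N.r_coset_hom_Mod N.factorgroup_is_group group_axioms
    by (auto simp: group_hom_def group_hom_axioms_def)
  have carr: "carrier (G Mod N) = rcosets N" by (simp add: FactGroup_def)
  have inj: "x \<otimes> s = y" if "x \<in> F" "s \<in> insert \<one> S'" "y \<in> F" "N #> (x \<otimes> s) = N #> y" for x s y
  proof -
    have c: "x \<otimes> s \<in> carrier G" "y \<in> carrier G" using that F S' by auto
    have "x \<otimes> s \<in> N #> y" using that(4) rcos_self[OF c(1) sub] by simp
    then have "x \<otimes> s \<otimes> inv y \<in> N"
      using N.rcos_module[OF group_axioms c(2,1)] by simp
    moreover have "x \<otimes> s \<otimes> inv y \<in> insert \<one> E"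
      using that(1-3) unfolding E_def by force
    ultimately have "x \<otimes> s \<otimes> inv y = \<one>" using N(3) by blast
    then show ?thesis using c by (metis inv_equality inv_inv inv_closed)
  qed
  have surj: "?h ` carrier G = carrier (G Mod N)" by (simp add: carrier_FactGroup)
  have "finite (carrier (G Mod N))" using fin carr by simp
  from h.exists_section_with_small_cut[OF this surj S' sym F bd inj order_refl]
  obtain T where T: "T \<subseteq> carrier G" "bij_betw ?h T (rcosets N)"
    and bad: "real (card {(t,s) \<in> T \<times> S'. N #> (t \<otimes> s) \<in> rcosets N \<and> t \<otimes> s \<notin> T})
      \<le> 2 * (\<epsilon> / 2) * card (rcosets N)"
    unfolding carr by blast
  have "finite T" using T(2) fin bij_betw_finite by blast
  obtain X where X: "finite X" "X \<subseteq> N" "card X \<le> card {(t,s) \<in> T \<times> S'. t \<otimes> s \<notin> T}"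
    "generate (G\<lparr>carrier := N\<rparr>) X = N"
    using generate_Schreier[OF sub S' genS' \<open>finite T\<close> T] by blast
  have "N #> (t \<otimes> s) \<in> rcosets N" if "t \<in> T" "s \<in> S'" for t s
    using that T(1) S'(2) by (intro rcosetsI N.subset) auto
  then have "{(t,s) \<in> T \<times> S'. N #> (t \<otimes> s) \<in> rcosets N \<and> t \<otimes> s \<notin> T} = {(t,s) \<in> T \<times> S'. t \<otimes> s \<notin> T}"
    by blast
  then have "real (card X) \<le> \<epsilon> * card (rcosets N)"
    using bad X(3) by simp
  moreover have "min_generators (G\<lparr>carrier := N\<rparr>) \<le> card X"
    using X by (intro min_generators_le) auto
  ultimately show thesis
    using that[OF N(2)] by (simp add: group_index_def)
qed

lemma (in group) rank_gradient_zero: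
  assumes am: "amenable G" and rf: "residually_finite G" and inf: "infinite (carrier G)"
    and S: "finite S" "S \<subseteq> carrier G" "generate G S = carrier G"
  shows "rank_gradient G = 0"
proof -
  let ?q = "\<lambda>H. (real (min_generators (G\<lparr>carrier := H\<rparr>)) - 1) / real (group_index G H)"
  have nonneg: "0 \<le> ?q H" if "H \<in> finite_index_subgroups G" for H
    using min_generators_finite_index_pos[OF S inf that] by simp
  have bdd: "bdd_below (?q ` finite_index_subgroups G)"
    using nonneg by (intro bdd_belowI[of _ 0]) auto
  have ge: "0 \<le> rank_gradient G"
    unfolding rank_gradient_def
    using carrier_mem_finite_index_subgroups nonneg by (intro cINF_greatest) auto
  have le: "rank_gradient G \<le> \<epsilon>" if \<epsilon>: "\<epsilon> > 0" for \<epsilon>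
  proof -
    obtain N where N: "N \<in> finite_index_subgroups G"
      and le: "real (min_generators (G\<lparr>carrier := N\<rparr>)) \<le> \<epsilon> * real (group_index G N)"
      using exists_finite_index_few_generators[OF am rf S \<epsilon>] by blast
    have "?q N \<le> \<epsilon>"
      using le \<epsilon> by (cases "group_index G N = 0") (simp_all add: divide_le_eq)
    then show ?thesis
      unfolding rank_gradient_def by (rule cINF_lower2[OF bdd N])
  qed
  have "rank_gradient G \<le> 0"
    by (rule field_le_epsilon) (use le in fastforce)
  with ge show ?thesis by (rule antisym[rotated])
qed


section \<open>Homotopies of paths relative to their endpoints\<close>

text \<open>Homotopy relative to the endpoints, the analogue of \<open>homotopic_paths\<close> for a space given as an
  abstract topology.\<close>
definition path_homotopic :: "'x topology \<Rightarrow> (real \<Rightarrow> 'x) \<Rightarrow> (real \<Rightarrow> 'x) \<Rightarrow> bool" where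
  "path_homotopic X p q \<longleftrightarrow>
     homotopic_with (\<lambda>r. r 0 = p 0 \<and> r 1 = p 1) (top_of_set {0..1}) X p q"

definition reverse_path :: "(real \<Rightarrow> 'x) \<Rightarrow> real \<Rightarrow> 'x" where
  "reverse_path p = (\<lambda>t. p (1 - t))"

lemma path_homotopicD:
  assumes "path_homotopic X p q"
  shows "pathin X p" "pathin X q" "q 0 = p 0" "q 1 = p 1"
  using homotopic_with_imp_continuous_maps[OF assms[unfolded path_homotopic_def]]
    homotopic_with_imp_property[OF assms[unfolded path_homotopic_def]]
  by (auto simp: pathin_def)

lemma path_homotopic_refl: "pathin X p \<Longrightarrow> path_homotopic X p p"
  by (simp add: path_homotopic_def pathin_def)

lemma path_homotopic_sym:
  assumes "path_homotopic X p q"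
  shows "path_homotopic X q p"
  using homotopic_with_symD[OF assms[unfolded path_homotopic_def]] path_homotopicD[OF assms]
  by (simp add: path_homotopic_def)

lemma path_homotopic_trans [trans]:
  assumes "path_homotopic X p q" "path_homotopic X q r"
  shows "path_homotopic X p r"
  using homotopic_with_trans[OF assms(1)[unfolded path_homotopic_def]]
    assms(2) path_homotopicD[OF assms(1)]
  by (simp add: path_homotopic_def)

text \<open>All groupoid laws below follow from this one fact: two reparametrizations of a path with the
  same endpoints are joined by the straight line homotopy of the parameters.\<close>
lemma path_homotopic_reparametrize:
  assumes w: "pathin X w"
    and f: "continuous_on {0..1} f" "f \<in> {0..1} \<rightarrow> {0..1}"
    and g: "continuous_on {0..1} g" "g \<in> {0..1} \<rightarrow> {0..1}"
    and ends: "f 0 = g 0" "f 1 = g 1"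
  shows "path_homotopic X (\<lambda>t. w (f t)) (\<lambda>t. w (g t))"
proof -
  have "homotopic_paths {0..1::real} f g"
  proof (rule homotopic_paths_linear)
    show "closed_segment (f t) (g t) \<subseteq> {0..1}" if "t \<in> {0..1}" for t
      using that f g by (intro closed_segment_subset) auto
  qed (use f g ends in \<open>auto simp: path_def pathstart_def pathfinish_def\<close>)
  then have "homotopic_with (\<lambda>r. r 0 = w (f 0) \<and> r 1 = w (f 1)) (top_of_set {0..1}) X (w \<circ> f) (w \<circ> g)"
    unfolding homotopic_paths_def
    by (rule homotopic_with_compose_continuous_map_left)
      (use w in \<open>auto simp: pathin_def pathstart_def pathfinish_def\<close>)
  then show ?thesis by (simp add: path_homotopic_def o_def)
qed

lemma loop_concat_0 [simp]: "loop_concat p q 0 = p 0"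
  and loop_concat_1 [simp]: "loop_concat p q 1 = q 1"
  by (simp_all add: loop_concat_def)

lemma reverse_path_0 [simp]: "reverse_path p 0 = p 1"
  and reverse_path_1 [simp]: "reverse_path p 1 = p 0"
  by (simp_all add: reverse_path_def)

lemma path_homotopic_concat:
  assumes pp: "path_homotopic X p p'" and qq: "path_homotopic X q q'" and pq: "p 1 = q 0"
  shows "path_homotopic X (loop_concat p q) (loop_concat p' q')"
proof -
  let ?I = "top_of_set {0..1::real}"
  let ?X01 = "prod_topology ?I ?I"
  obtain h where h: "continuous_map ?X01 X h" "\<And>t. h (0,t) = p t" "\<And>t. h (1,t) = p' t"
    "\<And>s. s \<in> {0..1} \<Longrightarrow> h (s,0) = p 0 \<and> h (s,1) = p 1"
    using pp by (auto simp: path_homotopic_def homotopic_with_def)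
  obtain k where k: "continuous_map ?X01 X k" "\<And>t. k (0,t) = q t" "\<And>t. k (1,t) = q' t"
    "\<And>s. s \<in> {0..1} \<Longrightarrow> k (s,0) = q 0 \<and> k (s,1) = q 1"
    using qq by (auto simp: path_homotopic_def homotopic_with_def)
  define H where "H y = (if snd y \<le> 1/2 then (h \<circ> (\<lambda>y. (fst y, 2 * snd y))) y
      else (k \<circ> (\<lambda>y. (fst y, 2 * snd y - 1))) y)" for y :: "real \<times> real"
  have X01: "?X01 = top_of_set ({0..1} \<times> {0..1})"
    by (simp add: prod_topology_subtopology_eu)
  show ?thesis
    unfolding path_homotopic_def homotopic_with_def
  proof (intro exI conjI)
    show "continuous_map ?X01 X H"
      unfolding H_def
    proof (rule continuous_map_cases_le)
      show "continuous_map (subtopology ?X01 {y \<in> topspace ?X01. snd y \<le> 1/2}) X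
               (h \<circ> (\<lambda>y. (fst y, 2 * snd y)))"
        by (rule continuous_map_compose[OF _ h(1)])
          (auto simp: X01 subtopology_subtopology intro!: continuous_intros)
      show "continuous_map (subtopology ?X01 {y \<in> topspace ?X01. 1/2 \<le> snd y}) X
               (k \<circ> (\<lambda>y. (fst y, 2 * snd y - 1)))"
        by (rule continuous_map_compose[OF _ k(1)])
          (auto simp: X01 subtopology_subtopology intro!: continuous_intros)
      show "(h \<circ> (\<lambda>y. (fst y, 2 * snd y))) y = (k \<circ> (\<lambda>y. (fst y, 2 * snd y - 1))) y"
        if "y \<in> topspace ?X01" "snd y = 1/2" for y
      proof -
        have "2 * snd y = 1" "fst y \<in> {0..1}" using that by (auto simp: X01)
        then show ?thesis using h(4)[of "fst y"] k(4)[of "fst y"] pq by simp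
      qed
    qed (auto simp: X01 intro!: continuous_intros)
    show "\<forall>t. H (0,t) = loop_concat p q t" "\<forall>t. H (1,t) = loop_concat p' q' t"
      by (auto simp: H_def loop_concat_def h k)
    show "\<forall>s\<in>{0..1}. H (s,0) = loop_concat p q 0 \<and> H (s,1) = loop_concat p q 1"
      using h(4) k(4) by (auto simp: H_def)
  qed
qed

lemma pathin_concat: "\<lbrakk>pathin X p; pathin X q; p 1 = q 0\<rbrakk> \<Longrightarrow> pathin X (loop_concat p q)"
  using path_homotopic_concat[OF path_homotopic_refl path_homotopic_refl]
  by (blast dest: path_homotopicD)

lemma pathin_reparametrize:
  assumes "pathin X w" "continuous_on {0..1} f" "f \<in> {0..1} \<rightarrow> {0..1}"
  shows "pathin X (\<lambda>t. w (f t))"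
  using path_homotopicD[OF path_homotopic_reparametrize[OF assms assms(2,3)]] by simp

lemma pathin_reverse: "pathin X p \<Longrightarrow> pathin X (reverse_path p)"
  unfolding reverse_path_def by (rule pathin_reparametrize) (auto intro!: continuous_intros)

lemma path_homotopic_concat_assoc:
  assumes "pathin X p" "pathin X q" "pathin X r" "p 1 = q 0" "q 1 = r 0"
  shows "path_homotopic X (loop_concat (loop_concat p q) r) (loop_concat p (loop_concat q r))"
proof -
  let ?w = "loop_concat (loop_concat p q) r"
  let ?f = "\<lambda>t::real. max (t/2) (max (t - 1/4) (2 * t - 1))"
  have "path_homotopic X (\<lambda>t. ?w t) (\<lambda>t. ?w (?f t))"
    by (rule path_homotopic_reparametrize)
      (use assms in \<open>auto intro!: continuous_intros pathin_concat simp: le_max_iff_disj\<close>)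
  moreover have "?w (?f t) = loop_concat p (loop_concat q r) t" for t
  proof -
    consider "t \<le> 1/2" | "1/2 < t" "t \<le> 3/4" | "3/4 < t" by linarith
    then show ?thesis
    proof cases
      case 1
      then have "?f t = t/2" by (auto simp: max_def)
      then show ?thesis using 1 by (simp add: loop_concat_def)
    next
      case 2
      then have "?f t = t - 1/4" by (auto simp: max_def)
      moreover have "2 * (2 * (t - 1/4)) - 1 = 2 * (2 * t - 1)" by simp
      ultimately show ?thesis using 2 by (simp add: loop_concat_def)
    next
      case 3
      then have "?f t = 2 * t - 1" by (auto simp: max_def)
      then show ?thesis using 3 by (simp add: loop_concat_def)
    qed
  qed
  ultimately show ?thesis by simp
qed

lemma path_homotopic_concat_const:
  assumes "pathin X p"
  shows "path_homotopic X (loop_concat p (\<lambda>_. p 1)) p"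
proof -
  have "path_homotopic X (\<lambda>t. p (min (2 * t) 1)) (\<lambda>t. p t)"
    by (rule path_homotopic_reparametrize) (use assms in \<open>auto intro!: continuous_intros\<close>)
  moreover have "p (min (2 * t) 1) = loop_concat p (\<lambda>_. p 1) t" for t
    by (auto simp: loop_concat_def min_def)
  ultimately show ?thesis by simp
qed

lemma path_homotopic_reverse_concat:
  assumes "pathin X p"
  shows "path_homotopic X (loop_concat (reverse_path p) p) (\<lambda>_. p 1)"
proof -
  have "path_homotopic X (\<lambda>t. p \<bar>1 - 2 * t\<bar>) (\<lambda>t. p 1)"
    by (rule path_homotopic_reparametrize[where g = "\<lambda>_. 1"])
      (use assms in \<open>auto intro!: continuous_intros\<close>)
  moreover have "p \<bar>1 - 2 * t\<bar> = loop_concat (reverse_path p) p t" for t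
    by (auto simp: loop_concat_def reverse_path_def abs_if)
  ultimately show ?thesis by simp
qed

lemma path_homotopic_split:
  assumes "pathin X p" "0 \<le> s" "s \<le> u" "u \<le> 1"
  shows "path_homotopic X (\<lambda>t. p (u * t)) (loop_concat (\<lambda>t. p (s * t)) (\<lambda>t. p (s + (u - s) * t)))"
proof -
  let ?g = "\<lambda>t. s * min (2 * t) 1 + (u - s) * max (2 * t - 1) 0"
  have g: "?g \<in> {0..1} \<rightarrow> {0..1}"
  proof
    fix t :: real assume t: "t \<in> {0..1}"
    have "0 \<le> ?g t"
      using t assms by (intro add_nonneg_nonneg mult_nonneg_nonneg) auto
    moreover have "?g t \<le> s * 1 + (u - s) * 1"
      using t assms by (intro add_mono mult_left_mono) auto
    ultimately show "?g t \<in> {0..1}" using assms by auto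
  qed
  have "path_homotopic X (\<lambda>t. p (u * t)) (\<lambda>t. p (?g t))"
    by (rule path_homotopic_reparametrize)
      (use assms g in \<open>auto intro!: continuous_intros mult_le_one\<close>)
  moreover have "p (?g t) = loop_concat (\<lambda>t. p (s * t)) (\<lambda>t. p (s + (u - s) * t)) t" for t
    by (auto simp: loop_concat_def min_def max_def)
  ultimately show ?thesis by simp
qed

section \<open>Locally path simple spaces\<close>

text \<open>The homotopies are allowed to leave \<open>U\<close>, as in the definition of semilocal simple connectedness.\<close>
definition path_simple_open :: "'x topology \<Rightarrow> 'x set \<Rightarrow> bool" where
  "path_simple_open X U \<longleftrightarrow> openin X U \<and> path_connectedin X U \<and>
     (\<forall>p q. pathin X p \<longrightarrow> pathin X q \<longrightarrow> p \<in> {0..1} \<rightarrow> U \<longrightarrow> q \<in> {0..1} \<rightarrow> U \<longrightarrow>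
        p 0 = q 0 \<longrightarrow> p 1 = q 1 \<longrightarrow> path_homotopic X p q)"

lemma path_simple_openD:
  "\<lbrakk>path_simple_open X U; pathin X p; pathin X q; p \<in> {0..1} \<rightarrow> U; q \<in> {0..1} \<rightarrow> U;
    p 0 = q 0; p 1 = q 1\<rbrakk> \<Longrightarrow> path_homotopic X p q"
  unfolding path_simple_open_def by blast

definition locally_path_simple :: "'x topology \<Rightarrow> bool" where
  "locally_path_simple X \<longleftrightarrow>
     (\<forall>W x. openin X W \<longrightarrow> x \<in> W \<longrightarrow> (\<exists>U. path_simple_open X U \<and> x \<in> U \<and> U \<subseteq> W))"

lemma open_fun_contains_convex_box:
  fixes O' :: "('i \<Rightarrow> real) set"
  assumes "open O'" "a \<in> O'"
  obtains B where "open B" "a \<in> B" "B \<subseteq> O'"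
    "\<And>z w s. \<lbrakk>z \<in> B; w \<in> B; s \<in> {0..1}\<rbrakk> \<Longrightarrow> (\<lambda>i. (1 - s) * z i + s * w i) \<in> B"
proof -
  have "openin (product_topology (\<lambda>_::'i. euclideanreal) UNIV) O'"
    using assms by (simp add: euclidean_product_topology)
  from product_topology_open_contains_basis[OF this assms(2)]
  obtain X where X: "a \<in> (\<Pi>\<^sub>E i\<in>UNIV. X i)" "\<And>i. open (X i)" "finite {i. X i \<noteq> UNIV}"
    "(\<Pi>\<^sub>E i\<in>UNIV. X i) \<subseteq> O'"
    by auto
  have "\<exists>e>0. ball (a i) e \<subseteq> X i" for i
    using X(1,2) open_contains_ball by (fastforce simp: PiE_def Pi_def)
  then obtain e where e: "\<And>i. e i > 0" "\<And>i. ball (a i) (e i) \<subseteq> X i"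
    by metis
  define B where "B = {f. \<forall>i\<in>{i. X i \<noteq> UNIV}. f i \<in> ball (a i) (e i)}"
  show thesis
  proof
    show "open B"
      unfolding B_def by (rule product_topology_basis'[OF X(3)]) auto
    show "a \<in> B" using e by (simp add: B_def)
    have "f i \<in> X i" if "f \<in> B" for f i
    proof (cases "X i = UNIV")
      case False
      then have "f i \<in> ball (a i) (e i)" using that unfolding B_def by blast
      then show ?thesis using e(2) by blast
    qed simp
    then show "B \<subseteq> O'" using X(4) by (auto simp: PiE_def)
    fix z w :: "'i \<Rightarrow> real" and s :: real
    assume "z \<in> B" "w \<in> B" "s \<in> {0..1}"
    then show "(\<lambda>i. (1 - s) * z i + s * w i) \<in> B"
      using convexD_alt[OF convex_ball, of "z i" "a i" "e i" "w i" s for i]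
      by (auto simp: B_def)
  qed
qed

text \<open>Both segments and straight line homotopies between paths stay in the convex set \<open>C\<close>, from which \<open>g\<close> carries them to \<open>U\<close>.\<close>
lemma path_simple_open_convex_chart:
  fixes C :: "('i \<Rightarrow> real) set"
  assumes op: "openin X U" and g: "continuous_map (top_of_set C) X g" "g ` C = U"
    and f: "continuous_map (subtopology X U) (top_of_set C) f"
    and gf: "\<And>x. x \<in> U \<Longrightarrow> g (f x) = x"
    and conv: "\<And>z w s. \<lbrakk>z \<in> C; w \<in> C; s \<in> {0..1}\<rbrakk> \<Longrightarrow> (\<lambda>i. (1 - s) * z i + s * w i) \<in> C"
  shows "path_simple_open X U"
  unfolding path_simple_open_def
proof (intro conjI allI impI)
  show "openin X U" by (rule op)
  have UX: "U \<subseteq> topspace X" using op by (rule openin_subset)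
  have fC: "f x \<in> C" if "x \<in> U" for x
    using continuous_map_image_subset_topspace[OF f] that UX by auto
  have "path_connected_space (top_of_set C)"
    unfolding path_connected_space_def
  proof (intro ballI)
    fix z w assume zw: "z \<in> topspace (top_of_set C)" "w \<in> topspace (top_of_set C)"
    have "pathin (top_of_set C) (\<lambda>s i. (1 - s) * z i + s * w i)"
      unfolding pathin_def using zw conv by (auto intro!: continuous_intros)
    then show "\<exists>g. pathin (top_of_set C) g \<and> g 0 = z \<and> g 1 = w"
      by (intro exI[of _ "\<lambda>s i. (1 - s) * z i + s * w i"]) auto
  qed
  then have "path_connectedin (top_of_set C) C"
    by (simp add: path_connectedin_def subtopology_subtopology)
  then show "path_connectedin X U"
    using path_connectedin_continuous_map_image[OF g(1)] g(2) by metis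
next
  fix p q assume p: "pathin X p" "p \<in> {0..1} \<rightarrow> U" and q: "pathin X q" "q \<in> {0..1} \<rightarrow> U"
    and ends: "p 0 = q 0" "p 1 = q 1"
  let ?I = "top_of_set {0..1::real}"
  let ?X01 = "prod_topology ?I ?I"
  have X01: "?X01 = top_of_set ({0..1} \<times> {0..1})"
    by (simp add: prod_topology_subtopology_eu)
  have cf: "continuous_on {0..1} (f \<circ> r)" "f \<circ> r \<in> {0..1} \<rightarrow> C" if "pathin X r" "r \<in> {0..1} \<rightarrow> U" for r
  proof -
    have "continuous_map ?I (subtopology X U) r"
      using that by (auto simp: pathin_def continuous_map_in_subtopology)
    from continuous_map_compose[OF this f]
    show "continuous_on {0..1} (f \<circ> r)" "f \<circ> r \<in> {0..1} \<rightarrow> C" by auto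
  qed
  define H where "H y = (\<lambda>i. (1 - fst y) * (f \<circ> p) (snd y) i + fst y * (f \<circ> q) (snd y) i)"
    for y :: "real \<times> real"
  have contH: "continuous_map ?X01 (top_of_set C) H"
  proof -
    have coord: "continuous_on ({0..1} \<times> {0..1}) (\<lambda>y. (f \<circ> r) (snd y) i)"
      if "pathin X r" "r \<in> {0..1} \<rightarrow> U" for r i
    proof -
      have "continuous_on {0..1} (\<lambda>t. (f \<circ> r) t i)"
        using cf(1)[OF that] by (rule continuous_on_product_then_coordinatewise)
      then show ?thesis
        by (rule continuous_on_compose2) (auto intro!: continuous_intros)
    qed
    have "continuous_on ({0..1} \<times> {0..1}) H"
      unfolding H_def
      by (intro continuous_on_coordinatewise_then_product continuous_intros coord p q)
    moreover have "H y \<in> C" if "y \<in> {0..1} \<times> {0..1}" for y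
      unfolding H_def by (rule conv) (use that cf(2)[OF p] cf(2)[OF q] in auto)
    ultimately show ?thesis by (auto simp: X01)
  qed
  have "homotopic_with (\<lambda>r. r 0 = p 0 \<and> r 1 = p 1) ?I X p q"
  proof (subst homotopic_with)
    show "(r 0 = p 0 \<and> r 1 = p 1) = (k 0 = p 0 \<and> k 1 = p 1)"
      if "\<And>x. x \<in> topspace ?I \<Longrightarrow> r x = k x" for r k :: "real \<Rightarrow> 'a"
      using that[of 0] that[of 1] by simp
    have U01: "p t \<in> U" "q t \<in> U" if "t \<in> {0..1}" for t
      using that p q by auto
    show "\<exists>h. continuous_map ?X01 X h \<and> (\<forall>x\<in>topspace ?I. h (0, x) = p x) \<and>
      (\<forall>x\<in>topspace ?I. h (1, x) = q x) \<and>
      (\<forall>t\<in>{0..1}. h (t, 0) = p 0 \<and> h (t, 1) = p 1)"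
    proof (intro exI[of _ "g \<circ> H"] conjI ballI)
      show "continuous_map ?X01 X (g \<circ> H)"
        by (rule continuous_map_compose[OF contH g(1)])
      show "(g \<circ> H) (0, x) = p x" if "x \<in> topspace ?I" for x
        using that U01[of x] gf by (simp add: H_def)
      show "(g \<circ> H) (1, x) = q x" if "x \<in> topspace ?I" for x
        using that U01[of x] gf by (simp add: H_def)
      fix t :: real
      have "(\<lambda>i. (1 - t) * f u i + t * f u i) = f u" for u
        by (simp add: algebra_simps)
      then show "(g \<circ> H) (t, 0) = p 0" "(g \<circ> H) (t, 1) = p 1"
        using gf U01[of 0] U01[of 1] by (simp_all add: H_def flip: ends)
    qed
  qed
  then show "path_homotopic X p q" by (simp add: path_homotopic_def)
qed

text \<open>Small convex boxes in a chart are as required.\<close>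
lemma locally_euclidean_imp_locally_path_simple:
  assumes "locally_euclidean n X"
  shows "locally_path_simple X"
  unfolding locally_path_simple_def
proof (intro allI impI)
  fix W x assume W: "openin X W" "x \<in> W"
  then have "x \<in> topspace X" using openin_subset by blast
  then obtain U V where U: "openin X U" "x \<in> U" and V: "openin (Euclidean_space n) V"
    and "subtopology X U homeomorphic_space subtopology (Euclidean_space n) V"
    using assms by (auto simp: locally_euclidean_def)
  then obtain f g where fg: "homeomorphic_maps (subtopology X U) (subtopology (Euclidean_space n) V) f g"
    by (auto simp: homeomorphic_space_def)
  define Z :: "(nat \<Rightarrow> real) set" where "Z = {z. \<forall>i\<ge>n. z i = 0}"
  have E: "Euclidean_space n = top_of_set Z"
    by (simp add: Euclidean_space_def euclidean_product_topology Z_def)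
  have VZ: "V \<subseteq> Z" using openin_subset[OF V] by (simp add: E)
  have EV: "subtopology (Euclidean_space n) V = top_of_set V"
    using VZ by (simp add: E subtopology_subtopology inf.absorb2)
  have UX: "U \<subseteq> topspace X" using U(1) by (rule openin_subset)
  have f: "continuous_map (subtopology X U) (top_of_set V) f"
    and g: "continuous_map (top_of_set V) (subtopology X U) g"
    and gf: "\<And>x. x \<in> U \<Longrightarrow> g (f x) = x" and fg': "\<And>y. y \<in> V \<Longrightarrow> f (g y) = y"
    using fg UX by (auto simp: homeomorphic_maps_def EV)
  have fV: "f u \<in> V" if "u \<in> U" for u
    using continuous_map_image_subset_topspace[OF f] that UX by auto
  have gU: "g y \<in> U" if "y \<in> V" for y
    using continuous_map_image_subset_topspace[OF g] that by auto
  have "openin (top_of_set V) {y \<in> V. g y \<in> U \<inter> W}"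
  proof -
    have "openin (subtopology X U) (U \<inter> W)"
      using W(1) by (auto simp: openin_subtopology)
    from openin_continuous_map_preimage[OF g this] show ?thesis by simp
  qed
  then have "openin (top_of_set Z) {y \<in> V. g y \<in> U \<inter> W}"
    using V by (metis E openin_trans)
  then obtain O' where O': "open O'" "{y \<in> V. g y \<in> U \<inter> W} = Z \<inter> O'"
    by (auto simp: openin_open)
  have memO: "y \<in> V \<and> g y \<in> W" if "y \<in> Z" "y \<in> O'" for y
  proof -
    have "y \<in> {y \<in> V. g y \<in> U \<inter> W}" unfolding O'(2) using that by blast
    then show ?thesis by blast
  qed
  have "f x \<in> {y \<in> V. g y \<in> U \<inter> W}"
    using U(2) W(2) fV[of x] gf[of x] by simp
  then have fx: "f x \<in> Z" "f x \<in> O'"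
    unfolding O'(2) by blast+
  obtain B where B: "open B" "f x \<in> B" "B \<subseteq> O'"
    and conv: "\<And>z w s. \<lbrakk>z \<in> B; w \<in> B; s \<in> {0..1}\<rbrakk> \<Longrightarrow> (\<lambda>i. (1 - s) * z i + s * w i) \<in> B"
    using open_fun_contains_convex_box[OF O'(1) fx(2)] by metis
  define C where "C = Z \<inter> B"
  have C: "C \<subseteq> V" "\<And>y. y \<in> C \<Longrightarrow> g y \<in> W"
    using memO B(3) by (auto simp: C_def)
  have gC: "g ` C = {u \<in> U. f u \<in> C}"
  proof
    show "g ` C \<subseteq> {u \<in> U. f u \<in> C}" using C(1) gU fg' by (auto simp: subset_iff)
    show "{u \<in> U. f u \<in> C} \<subseteq> g ` C"
    proof
      fix u assume "u \<in> {u \<in> U. f u \<in> C}"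
      then have "u = g (f u)" "f u \<in> C" using gf by auto
      then show "u \<in> g ` C" by (rule image_eqI)
    qed
  qed
  have "openin (top_of_set V) C"
    using B(1) C(1) VZ by (auto simp: C_def openin_open)
  then have "openin (subtopology X U) {u \<in> topspace (subtopology X U). f u \<in> C}"
    by (rule openin_continuous_map_preimage[OF f])
  moreover have "{u \<in> topspace (subtopology X U). f u \<in> C} = g ` C"
    using UX by (auto simp: gC)
  ultimately have op: "openin X (g ` C)"
    using U(1) openin_trans_full by metis
  have "path_simple_open X (g ` C)"
  proof (rule path_simple_open_convex_chart[OF op _ refl])
    show "continuous_map (top_of_set C) X g"
      using g C(1) by (metis continuous_map_from_subtopology_mono continuous_map_in_subtopology)
    have "continuous_map (subtopology X (g ` C)) (top_of_set V) f"
      using f gC by (metis (no_types, lifting) continuous_map_from_subtopology_mono mem_Collect_eq subsetI)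
    moreover have "f ` (g ` C) \<subseteq> C" using C(1) fg' by auto
    ultimately show "continuous_map (subtopology X (g ` C)) (top_of_set C) f"
      by (auto simp: continuous_map_in_subtopology)
    show "g (f u) = u" if "u \<in> g ` C" for u
      using that gC gf by auto
    show "(\<lambda>i. (1 - s) * z i + s * w i) \<in> C" if "z \<in> C" "w \<in> C" "s \<in> {0..1}" for z w s
      using that conv[of z w s] by (auto simp: C_def Z_def)
  qed
  moreover have "x \<in> g ` C"
    unfolding gC using U(2) fx(1) B(2) by (simp add: C_def)
  ultimately show "\<exists>U. path_simple_open X U \<and> x \<in> U \<and> U \<subseteq> W"
    using C(2) by blast
qed

section \<open>Finitely many loops generate the fundamental group\<close>

text \<open>Products of loops without inverses suffice to generate, since the generating set below contains
  enough loops to walk along an arbitrary loop in one direction.\<close>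
inductive_set loop_words :: "'x \<Rightarrow> (real \<Rightarrow> 'x) set \<Rightarrow> (real \<Rightarrow> 'x) set" for x T where
  const: "(\<lambda>_. x) \<in> loop_words x T"
| concat: "\<lbrakk>w \<in> loop_words x T; p \<in> T\<rbrakk> \<Longrightarrow> loop_concat w p \<in> loop_words x T"

lemma const_loop: "x \<in> topspace X \<Longrightarrow> (\<lambda>_. x) \<in> loops X x"
  by (simp add: loops_def)

lemma concat_loop: "\<lbrakk>p \<in> loops X x; q \<in> loops X x\<rbrakk> \<Longrightarrow> loop_concat p q \<in> loops X x"
  by (simp add: loops_def pathin_concat)

lemma loop_words_subset_loops:
  assumes "x \<in> topspace X" "T \<subseteq> loops X x"
  shows "loop_words x T \<subseteq> loops X x"
proof
  fix w assume "w \<in> loop_words x T"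
  then show "w \<in> loops X x"
    by induction (use assms in \<open>auto intro: const_loop concat_loop\<close>)
qed

text \<open>The Lebesgue number of the preimages of the cover in the unit interval.\<close>
lemma path_partition:
  assumes p: "pathin X p" and cov: "topspace X \<subseteq> \<Union>\<V>" "\<And>V. V \<in> \<V> \<Longrightarrow> openin X V"
  obtains m :: nat where "m > 0"
    "\<And>k. k < m \<Longrightarrow> \<exists>V\<in>\<V>. \<forall>t\<in>{real k / real m..(real k + 1) / real m}. p t \<in> V"
proof -
  have "\<exists>Q. open Q \<and> {t \<in> {0..1}. p t \<in> V} = {0..1} \<inter> Q" if "V \<in> \<V>" for V
  proof -
    have "openin (top_of_set {0..1}) {t \<in> topspace (top_of_set {0..1}). p t \<in> V}"
      using p cov(2)[OF that] unfolding pathin_def by (rule openin_continuous_map_preimage)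
    then show ?thesis by (simp add: openin_open)
  qed
  then obtain Q where Q: "\<And>V. V \<in> \<V> \<Longrightarrow> open (Q V)"
    "\<And>V. V \<in> \<V> \<Longrightarrow> {t \<in> {0..1}. p t \<in> V} = {0..1} \<inter> Q V"
    by metis
  have "{0..1} \<subseteq> \<Union>(Q ` \<V>)"
  proof
    fix t :: real assume t: "t \<in> {0..1}"
    then have "p t \<in> topspace X"
      using p path_image_subset_topspace by fastforce
    then obtain V where V: "V \<in> \<V>" "p t \<in> V" using cov by blast
    then have "t \<in> {0..1} \<inter> Q V" using t Q(2)[OF V(1)] by blast
    then show "t \<in> \<Union>(Q ` \<V>)" using V by blast
  qed
  moreover have "open G" if "G \<in> Q ` \<V>" for G
    using that Q(1) by blast
  ultimately obtain e where e: "e > 0" "\<And>t. t \<in> {0..1} \<Longrightarrow> \<exists>G\<in>Q ` \<V>. ball t e \<subseteq> G"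
    by (rule Heine_Borel_lemma[OF compact_Icc]) blast+
  obtain m :: nat where m: "m > 0" "1 / real m < e"
    using real_arch_inverse[of e] e(1) by (auto simp: inverse_eq_divide)
  show thesis
  proof
    show "m > 0" by (rule m)
    fix k assume k: "k < m"
    then obtain V where V: "V \<in> \<V>" "ball (k / m) e \<subseteq> Q V"
      using e(2)[of "k / m"] by auto
    have "p t \<in> V" if t: "t \<in> {real k / real m..(real k + 1) / real m}" for t
    proof -
      have "(real k + 1) / m = k / m + 1 / m" by (simp add: add_divide_distrib)
      then have "t \<in> ball (k / m) e"
        using t m(2) by (auto simp: dist_real_def)
      moreover have "t \<in> {0..1}"
      proof -
        have "0 \<le> real k / m" "(real k + 1) / m \<le> 1" using k by auto
        then show ?thesis using t unfolding atLeastAtMost_iff by linarith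
      qed
      ultimately show ?thesis using V Q(2)[OF V(1)] by blast
    qed
    then show "\<exists>V\<in>\<V>. \<forall>t\<in>{real k / real m..(real k + 1) / real m}. p t \<in> V" using V by blast
  qed
qed

text \<open>Choose finitely many \<open>V i \<subseteq> K i \<subseteq> U i\<close>, with \<open>V i\<close> open and covering, \<open>K i\<close> closed, and \<open>U i\<close> path
  simple. As \<open>K i \<inter> K j\<close> is compact, finitely many points \<open>P i j\<close> are enough to reach each point of
  \<open>V i \<inter> V j\<close> by a path inside \<open>U i \<inter> U j\<close>. Passing to smaller sets is essential here, because
  \<open>U i \<inter> U j\<close> itself may have infinitely many components.

  Let \<open>\<beta> i y\<close> run from the base point to \<open>y \<in> U i\<close> via the centre of \<open>U i\<close>. Up to homotopy it does not
  matter how it gets to \<open>y\<close> inside \<open>U i\<close> (\<open>slide\<close>), so at a point of \<open>V i \<inter> V j\<close> one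
  can replace \<open>\<beta> i\<close> by \<open>\<beta> j\<close> at the cost of one of the finitely many loops \<open>g i j q\<close> with \<open>q \<in> P i j\<close>
  (\<open>switch\<close>). Following a loop along a subdivision and switching at each cut point expresses it as
  a product of these loops, together with \<open>\<beta> i x0\<close> and its reverse at the two ends.\<close>
lemma finitely_many_loops_generate:
  assumes comp: "compact_space X" and haus: "Hausdorff_space X"
    and conn: "path_connected_space X" and loc: "locally_path_simple X"
    and x0: "x0 \<in> topspace X"
  obtains T where "finite T" "T \<subseteq> loops X x0"
    "\<And>p. p \<in> loops X x0 \<Longrightarrow> \<exists>w\<in>loop_words x0 T. path_homotopic X p w"
proof -
  have "regular_space X" using comp haus by (rule compact_Hausdorff_imp_regular_space)
  then have "neighbourhood_base_of (closedin X) X"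
    by (simp only: neighbourhood_base_of_closedin)
  then have reg: "\<exists>V K. openin X V \<and> closedin X K \<and> x \<in> V \<and> V \<subseteq> K \<and> K \<subseteq> W"
    if "openin X W" "x \<in> W" for W x
    using that neighbourhood_base_of[of "closedin X" X] by simp
  have "\<exists>U V K. path_simple_open X U \<and> openin X V \<and> closedin X K \<and> x \<in> V \<and> V \<subseteq> K \<and> K \<subseteq> U"
    if "x \<in> topspace X" for x
  proof -
    note x = that
    obtain U where U: "path_simple_open X U" "x \<in> U"
      using loc[unfolded locally_path_simple_def, rule_format, OF openin_topspace x] by blast
    then have "openin X U" by (simp add: path_simple_open_def)
    from reg[OF this U(2)] show ?thesis using U(1) by blast
  qed
  then have "\<forall>x\<in>topspace X. \<exists>U V K. path_simple_open X U \<and> openin X V \<and> closedin X K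
      \<and> x \<in> V \<and> V \<subseteq> K \<and> K \<subseteq> U"
    by blast
  then obtain U V K where "\<forall>x\<in>topspace X. path_simple_open X (U x) \<and> openin X (V x)
      \<and> closedin X (K x) \<and> x \<in> V x \<and> V x \<subseteq> K x \<and> K x \<subseteq> U x"
    unfolding bchoice_iff by blast
  then have UVK: "path_simple_open X (U x)" "openin X (V x)" "closedin X (K x)" "x \<in> V x"
    "V x \<subseteq> K x" "K x \<subseteq> U x" if "x \<in> topspace X" for x
    using that by blast+
  have "\<exists>\<F>. finite \<F> \<and> \<F> \<subseteq> V ` topspace X \<and> topspace X \<subseteq> \<Union>\<F>"
  proof -
    have "\<forall>W\<in>V ` topspace X. openin X W" "topspace X \<subseteq> \<Union>(V ` topspace X)"
      using UVK(2,4) by blast+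
    then show ?thesis
      using comp unfolding compact_space_def compactin_def by meson
  qed
  then obtain I where I: "finite I" "I \<subseteq> topspace X" "topspace X \<subseteq> \<Union>(V ` I)"
    by (metis finite_subset_image)
  have opU: "openin X (U i)" and pcU: "path_connectedin X (U i)" if "i \<in> I" for i
    using that I UVK(1) by (auto simp: path_simple_open_def)
  have iU: "i \<in> U i" if "i \<in> I" for i
    using that I UVK(4-6) by blast
  have "\<exists>P. finite P \<and> P \<subseteq> U i \<inter> U j \<and> (\<forall>y \<in> V i \<inter> V j. \<exists>q\<in>P. \<exists>p. pathin X p \<and>
      p \<in> {0..1} \<rightarrow> U i \<inter> U j \<and> p 0 = q \<and> p 1 = y)" if ij: "i \<in> I" "j \<in> I" for i j
  proof -
    let ?W = "U i \<inter> U j"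
    have "compactin X (K i \<inter> K j)"
      using ij I UVK(3) comp by (intro closedin_compact_space closedin_Int) auto
    have W: "openin X ?W" using opU ij by blast
    have "\<exists>N. path_simple_open X N \<and> y \<in> N \<and> N \<subseteq> ?W" if "y \<in> K i \<inter> K j" for y
    proof -
      have "y \<in> ?W" using that ij I UVK(6) by blast
      then show ?thesis by (rule loc[unfolded locally_path_simple_def, rule_format, OF W])
    qed
    then obtain N where N: "\<And>y. y \<in> K i \<inter> K j \<Longrightarrow> path_simple_open X (N y)"
      "\<And>y. y \<in> K i \<inter> K j \<Longrightarrow> y \<in> N y" "\<And>y. y \<in> K i \<inter> K j \<Longrightarrow> N y \<subseteq> ?W"
      by metis
    have "\<forall>O'\<in>N ` (K i \<inter> K j). openin X O'" using N(1) by (auto simp: path_simple_open_def)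
    moreover have "K i \<inter> K j \<subseteq> \<Union>(N ` (K i \<inter> K j))" using N(2) by blast
    ultimately obtain \<F> where "finite \<F>" "\<F> \<subseteq> N ` (K i \<inter> K j)" "K i \<inter> K j \<subseteq> \<Union>\<F>"
      using \<open>compactin X (K i \<inter> K j)\<close> unfolding compactin_def by meson
    then obtain P where P: "finite P" "P \<subseteq> K i \<inter> K j" "K i \<inter> K j \<subseteq> \<Union>(N ` P)"
      by (metis finite_subset_image)
    have "\<exists>q\<in>P. \<exists>p. pathin X p \<and> p \<in> {0..1} \<rightarrow> ?W \<and> p 0 = q \<and> p 1 = y"
      if y: "y \<in> V i \<inter> V j" for y
    proof -
      have "y \<in> K i \<inter> K j" using y ij I UVK(5) by blast
      then obtain q where q: "q \<in> P" "y \<in> N q" using P by blast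
      then have "q \<in> K i \<inter> K j" using P(2) by blast
      note Nq = N[OF this]
      have "path_connectedin X (N q)" "q \<in> N q" "N q \<subseteq> ?W"
        using Nq by (auto simp: path_simple_open_def)
      then obtain p where "pathin X p" "p \<in> {0..1} \<rightarrow> N q" "p 0 = q" "p 1 = y"
        using q(2) unfolding path_connectedin by blast
      then show ?thesis using q(1) \<open>N q \<subseteq> ?W\<close> by blast
    qed
    moreover have "P \<subseteq> ?W" using P N(2,3) by blast
    ultimately show ?thesis using P(1) by blast
  qed
  then obtain P where P: "\<And>i j. \<lbrakk>i \<in> I; j \<in> I\<rbrakk> \<Longrightarrow> finite (P i j)"
    "\<And>i j. \<lbrakk>i \<in> I; j \<in> I\<rbrakk> \<Longrightarrow> P i j \<subseteq> U i \<inter> U j"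
    "\<And>i j y. \<lbrakk>i \<in> I; j \<in> I; y \<in> V i \<inter> V j\<rbrakk> \<Longrightarrow> \<exists>q\<in>P i j. \<exists>p. pathin X p \<and>
        p \<in> {0..1} \<rightarrow> U i \<inter> U j \<and> p 0 = q \<and> p 1 = y"
    by metis
  have "\<exists>p. pathin X p \<and> p 0 = x0 \<and> p 1 = i" if "i \<in> I" for i
    using conn x0 I that unfolding path_connected_space_def by blast
  then obtain \<alpha> where \<alpha>: "\<And>i. i \<in> I \<Longrightarrow> pathin X (\<alpha> i) \<and> \<alpha> i 0 = x0 \<and> \<alpha> i 1 = i"
    by metis
  have "\<exists>p. pathin X p \<and> p \<in> {0..1} \<rightarrow> U i \<and> p 0 = i \<and> p 1 = y" if "i \<in> I" "y \<in> U i" for i y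
    using pcU[OF that(1)] iU[OF that(1)] that(2) unfolding path_connectedin by blast
  then obtain \<sigma> where \<sigma>: "\<And>i y. \<lbrakk>i \<in> I; y \<in> U i\<rbrakk> \<Longrightarrow>
      pathin X (\<sigma> i y) \<and> \<sigma> i y \<in> {0..1} \<rightarrow> U i \<and> \<sigma> i y 0 = i \<and> \<sigma> i y 1 = y"
    by metis
  define \<beta> where "\<beta> i y = loop_concat (\<alpha> i) (\<sigma> i y)" for i y
  have \<beta>: "pathin X (\<beta> i y)" "\<beta> i y 0 = x0" "\<beta> i y 1 = y" if "i \<in> I" "y \<in> U i" for i y
    using \<alpha>[OF that(1)] \<sigma>[OF that] by (auto simp: \<beta>_def intro: pathin_concat)
  have slide: "path_homotopic X (loop_concat (\<beta> i (d 0)) d) (\<beta> i (d 1))"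
    if i: "i \<in> I" and d: "pathin X d" "d \<in> {0..1} \<rightarrow> U i" for i d
  proof -
    have dU: "d 0 \<in> U i" "d 1 \<in> U i" using d by auto
    note \<sigma>0 = \<sigma>[OF i dU(1)] and \<sigma>1 = \<sigma>[OF i dU(2)]
    have "loop_concat (\<sigma> i (d 0)) d \<in> {0..1} \<rightarrow> U i"
      using \<sigma>0 d by (auto simp: loop_concat_def Pi_iff)
    moreover have "pathin X (loop_concat (\<sigma> i (d 0)) d)"
      using \<sigma>0 d by (intro pathin_concat) auto
    moreover have "path_simple_open X (U i)" using UVK(1) i I(2) by blast
    ultimately have "path_homotopic X (loop_concat (\<sigma> i (d 0)) d) (\<sigma> i (d 1))"
      using \<sigma>0 \<sigma>1 by (intro path_simple_openD) auto
    then have "path_homotopic X (loop_concat (\<alpha> i) (loop_concat (\<sigma> i (d 0)) d)) (\<beta> i (d 1))"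
      unfolding \<beta>_def using \<alpha>[OF i] \<sigma>0 by (intro path_homotopic_concat path_homotopic_refl) auto
    moreover have "path_homotopic X (loop_concat (\<beta> i (d 0)) d)
        (loop_concat (\<alpha> i) (loop_concat (\<sigma> i (d 0)) d))"
      unfolding \<beta>_def using \<alpha>[OF i] \<sigma>0 d by (intro path_homotopic_concat_assoc) auto
    ultimately show ?thesis using path_homotopic_trans by blast
  qed
  define g where "g i j q = loop_concat (\<beta> i q) (reverse_path (\<beta> j q))" for i j q
  define J where "J = {i \<in> I. x0 \<in> U i}"
  define T where "T = (\<lambda>(i,j,q). g i j q) ` (SIGMA i:I. SIGMA j:I. P i j)
      \<union> (\<lambda>i. \<beta> i x0) ` J \<union> (\<lambda>i. reverse_path (\<beta> i x0)) ` J"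
  have finT: "finite T"
    unfolding T_def J_def using I(1) P(1) by (intro finite_UnI finite_imageI finite_SigmaI) auto
  have gT: "g i j q \<in> T" if "i \<in> I" "j \<in> I" "q \<in> P i j" for i j q
  proof -
    have "(i,j,q) \<in> (SIGMA i:I. SIGMA j:I. P i j)" using that by blast
    then show ?thesis unfolding T_def by (metis (no_types, lifting) UnCI case_prod_conv image_eqI)
  qed
  have gL: "g i j q \<in> loops X x0" if "i \<in> I" "j \<in> I" "q \<in> U i \<inter> U j" for i j q
    using that \<beta>[of i q] \<beta>[of j q]
    by (auto simp: g_def loops_def intro!: pathin_concat pathin_reverse)
  have TL: "T \<subseteq> loops X x0"
  proof -
    have "\<beta> i x0 \<in> loops X x0" "reverse_path (\<beta> i x0) \<in> loops X x0" if "i \<in> J" for i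
      using that \<beta>[of i x0] by (auto simp: J_def loops_def intro: pathin_reverse)
    moreover have "g i j q \<in> loops X x0" if "i \<in> I" "j \<in> I" "q \<in> P i j" for i j q
      using that gL P(2) by blast
    ultimately show ?thesis unfolding T_def by auto
  qed
  have WL: "loop_words x0 T \<subseteq> loops X x0"
    using loop_words_subset_loops[OF x0 TL] .
  have switch: "\<exists>h\<in>T. path_homotopic X (\<beta> i y) (loop_concat h (\<beta> j y))"
    if ij: "i \<in> I" "j \<in> I" and y: "y \<in> V i \<inter> V j" for i j y
  proof -
    obtain q d where q: "q \<in> P i j" and d: "pathin X d" "d \<in> {0..1} \<rightarrow> U i \<inter> U j" "d 0 = q" "d 1 = y"
      using P(3)[OF ij y] by blast
    have qU: "q \<in> U i" "q \<in> U j" using q P(2)[OF ij] by auto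
    have dU: "d \<in> {0..1} \<rightarrow> U i" "d \<in> {0..1} \<rightarrow> U j" using d(2) by auto
    note \<beta>i = \<beta>[OF ij(1) qU(1)] and \<beta>j = \<beta>[OF ij(2) qU(2)]
    have "path_homotopic X (\<beta> i y) (loop_concat (\<beta> i q) d)"
      using slide[OF ij(1) d(1) dU(1)] d by (simp add: path_homotopic_sym)
    also have "path_homotopic X (loop_concat (\<beta> i q) d) (loop_concat (loop_concat (g i j q) (\<beta> j q)) d)"
    proof (rule path_homotopic_concat)
      have "path_homotopic X (loop_concat (g i j q) (\<beta> j q))
          (loop_concat (\<beta> i q) (loop_concat (reverse_path (\<beta> j q)) (\<beta> j q)))"
        unfolding g_def using \<beta>i \<beta>j by (intro path_homotopic_concat_assoc) (auto intro: pathin_reverse)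
      also have "path_homotopic X (loop_concat (\<beta> i q) (loop_concat (reverse_path (\<beta> j q)) (\<beta> j q)))
          (loop_concat (\<beta> i q) (\<lambda>_. \<beta> i q 1))"
        using \<beta>i \<beta>j path_homotopic_reverse_concat[OF \<beta>j(1)]
        by (intro path_homotopic_concat path_homotopic_refl) auto
      also have "path_homotopic X (loop_concat (\<beta> i q) (\<lambda>_. \<beta> i q 1)) (\<beta> i q)"
        using \<beta>i by (intro path_homotopic_concat_const)
      finally show "path_homotopic X (\<beta> i q) (loop_concat (g i j q) (\<beta> j q))"
        by (rule path_homotopic_sym)
    qed (use d \<beta>i in \<open>auto intro: path_homotopic_refl\<close>)
    also have "path_homotopic X (loop_concat (loop_concat (g i j q) (\<beta> j q)) d)
        (loop_concat (g i j q) (loop_concat (\<beta> j q) d))"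
      using gL[OF ij] qU \<beta>j d by (intro path_homotopic_concat_assoc) (auto simp: loops_def)
    also have "path_homotopic X (loop_concat (g i j q) (loop_concat (\<beta> j q) d))
        (loop_concat (g i j q) (\<beta> j y))"
      using gL[OF ij, of q] qU \<beta>j d slide[OF ij(2) d(1) dU(2)]
      by (intro path_homotopic_concat path_homotopic_refl) (auto simp: loops_def)
    finally show ?thesis using gT[OF ij q] by blast
  qed
  have "\<exists>w\<in>loop_words x0 T. path_homotopic X p w" if p: "p \<in> loops X x0" for p
  proof -
    have pin: "pathin X p" "p 0 = x0" "p 1 = x0" using p by (auto simp: loops_def)
    have "\<And>W. W \<in> V ` I \<Longrightarrow> openin X W" using UVK(2) I(2) by blast
    with path_partition[OF pin(1) I(3)] obtain m :: nat where m: "m > 0"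
      and part: "\<And>k. k < m \<Longrightarrow> \<exists>W\<in>V ` I. \<forall>t\<in>{real k / real m..(real k + 1) / real m}. p t \<in> W"
      by metis
    have VU: "y \<in> U i" if "i \<in> I" "y \<in> V i" for i y
      using that I UVK(5,6) by blast
    have "k \<le> m \<Longrightarrow> \<exists>w\<in>loop_words x0 T. \<exists>i\<in>I. p (k / m) \<in> V i \<and>
        path_homotopic X (\<lambda>t. p (k / m * t)) (loop_concat w (\<beta> i (p (k / m))))" for k
    proof (induction k)
      case 0
      obtain i where i: "i \<in> I" "x0 \<in> V i" using x0 I(3) by blast
      have iJ: "i \<in> J" using i VU by (simp add: J_def)
      note \<beta>i = \<beta>[OF i(1) VU[OF i]]
      let ?c = "\<lambda>_::real. x0" and ?r = "reverse_path (\<beta> i x0)"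
      have c: "pathin X ?c" using x0 by simp
      have "path_homotopic X (loop_concat (loop_concat ?c ?r) (\<beta> i x0))
          (loop_concat ?c (loop_concat ?r (\<beta> i x0)))"
        using c \<beta>i by (intro path_homotopic_concat_assoc) (auto intro: pathin_reverse)
      also have "path_homotopic X (loop_concat ?c (loop_concat ?r (\<beta> i x0))) (loop_concat ?c ?c)"
        using c \<beta>i path_homotopic_reverse_concat[OF \<beta>i(1)]
        by (intro path_homotopic_concat path_homotopic_refl) auto
      also have "loop_concat ?c ?c = ?c" by (auto simp: loop_concat_def)
      finally have "path_homotopic X ?c (loop_concat (loop_concat ?c ?r) (\<beta> i x0))"
        by (rule path_homotopic_sym)
      moreover have "loop_concat ?c ?r \<in> loop_words x0 T"
        using iJ by (intro loop_words.intros) (auto simp: T_def)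
      ultimately show ?case using i pin(2) by auto
    next
      case (Suc k)
      then obtain w i where w: "w \<in> loop_words x0 T" and i: "i \<in> I" "p (k / m) \<in> V i"
        and IH: "path_homotopic X (\<lambda>t. p (k / m * t)) (loop_concat w (\<beta> i (p (k / m))))"
        by auto
      have km: "k < m" using Suc.prems by simp
      obtain j where j: "j \<in> I" and jV: "\<And>t. t \<in> {real k / real m..(real k + 1) / real m} \<Longrightarrow> p t \<in> V j"
        using part[OF km] by blast
      let ?s = "real k / m" and ?u = "real (Suc k) / m"
      have su: "0 \<le> ?s" "?s \<le> ?u" "?u \<le> 1"
        using km by (auto simp: divide_right_mono)
      have u: "?u = (real k + 1) / real m" by simp
      have sV: "p ?s \<in> V j" and uV: "p ?u \<in> V j"
        using jV[of ?s] jV[of ?u] su(2) unfolding u by auto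
      define d where "d t = p (?s + (?u - ?s) * t)" for t
      have range: "?s + (?u - ?s) * t \<in> {?s..?u}" if "t \<in> {0..1}" for t
      proof -
        have "0 \<le> (?u - ?s) * t" "(?u - ?s) * t \<le> (?u - ?s) * 1"
          using su that by (auto intro!: mult_left_mono mult_nonneg_nonneg simp del: mult_1_right)
        then show ?thesis by auto
      qed
      have d: "pathin X d"
        unfolding d_def
      proof (rule pathin_reparametrize[OF pin(1)])
        show "(\<lambda>t. ?s + (?u - ?s) * t) \<in> {0..1} \<rightarrow> {0..1}"
          using range su by (force simp: Pi_iff)
      qed (auto intro!: continuous_intros)
      have d01: "d 0 = p ?s" "d 1 = p ?u" by (simp_all add: d_def)
      have dU: "d \<in> {0..1} \<rightarrow> U j"
      proof
        fix t :: real assume "t \<in> {0..1}"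
        then have "?s + (?u - ?s) * t \<in> {?s..(real k + 1) / real m}"
          using range[of t] by (simp only: u)
        then have "d t \<in> V j" unfolding d_def by (rule jV)
        then show "d t \<in> U j" by (rule VU[OF j])
      qed
      obtain h where h: "h \<in> T" "path_homotopic X (\<beta> i (p ?s)) (loop_concat h (\<beta> j (p ?s)))"
        using switch[OF i(1) j, of "p ?s"] i(2) sV by auto
      have wL: "w \<in> loops X x0" and hL: "h \<in> loops X x0" using w h WL TL by auto
      note \<beta>s = \<beta>[OF j VU[OF j sV]] and \<beta>u = \<beta>[OF j VU[OF j uV]]
      have wh: "loop_concat w h \<in> loop_words x0 T" using w h(1) by (rule loop_words.concat)
      have whL: "loop_concat w h \<in> loops X x0" using wL hL by (rule concat_loop)
      have "path_homotopic X (loop_concat w (\<beta> i (p ?s))) (loop_concat w (loop_concat h (\<beta> j (p ?s))))"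
        using wL h(2) \<beta>[OF i(1) VU[OF i]]
        by (intro path_homotopic_concat path_homotopic_refl) (auto simp: loops_def)
      also have "path_homotopic X (loop_concat w (loop_concat h (\<beta> j (p ?s))))
          (loop_concat (loop_concat w h) (\<beta> j (p ?s)))"
        using wL hL \<beta>s by (intro path_homotopic_sym[OF path_homotopic_concat_assoc]) (auto simp: loops_def)
      finally have step: "path_homotopic X (\<lambda>t. p (?s * t)) (loop_concat (loop_concat w h) (\<beta> j (p ?s)))"
        using IH path_homotopic_trans by blast
      have "path_homotopic X (\<lambda>t. p (?u * t)) (loop_concat (\<lambda>t. p (?s * t)) d)"
        unfolding d_def by (rule path_homotopic_split[OF pin(1) su])
      also have "path_homotopic X (loop_concat (\<lambda>t. p (?s * t)) d)
          (loop_concat (loop_concat (loop_concat w h) (\<beta> j (p ?s))) d)"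
        using step d d01 by (intro path_homotopic_concat path_homotopic_refl) auto
      also have "path_homotopic X (loop_concat (loop_concat (loop_concat w h) (\<beta> j (p ?s))) d)
          (loop_concat (loop_concat w h) (loop_concat (\<beta> j (p ?s)) d))"
        using whL \<beta>s d d01 by (intro path_homotopic_concat_assoc) (auto simp: loops_def)
      also have "path_homotopic X (loop_concat (loop_concat w h) (loop_concat (\<beta> j (p ?s)) d))
          (loop_concat (loop_concat w h) (\<beta> j (p ?u)))"
        using whL \<beta>s slide[OF j d dU] d01
        by (intro path_homotopic_concat path_homotopic_refl) (auto simp: loops_def)
      finally show ?case using wh j uV by blast
    qed
    from this[of m] m pin(3) obtain w i where w: "w \<in> loop_words x0 T" and i: "i \<in> I" "x0 \<in> V i"
      and hom: "path_homotopic X p (loop_concat w (\<beta> i x0))"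
      by auto
    have "\<beta> i x0 \<in> T" using i VU by (auto simp: T_def J_def)
    with w have "loop_concat w (\<beta> i x0) \<in> loop_words x0 T" by (rule loop_words.concat)
    then show ?thesis using hom by blast
  qed
  then show thesis using that finT TL by blast
qed
lemma loop_homotopy_iff:
  "(p, q) \<in> loop_homotopy X x \<longleftrightarrow> p \<in> loops X x \<and> q \<in> loops X x \<and> path_homotopic X p q"
  by (auto simp: loop_homotopy_def path_homotopic_def loops_def)

lemma equiv_loop_homotopy: "equiv (loops X x) (loop_homotopy X x)"
proof (rule equivI)
  show "loop_homotopy X x \<subseteq> loops X x \<times> loops X x"
    by (auto simp: loop_homotopy_iff)
  show "refl_on (loops X x) (loop_homotopy X x)"
    by (auto simp: refl_on_def loop_homotopy_iff loops_def path_homotopic_refl)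
  show "sym (loop_homotopy X x)"
    by (auto simp: sym_def loop_homotopy_iff path_homotopic_sym)
  show "trans (loop_homotopy X x)"
    unfolding trans_def loop_homotopy_iff by (blast intro: path_homotopic_trans)
qed

lemma fundamental_group_mult:
  assumes p: "p \<in> loops X x" and q: "q \<in> loops X x"
  shows "loop_homotopy X x `` {p} \<otimes>\<^bsub>fundamental_group X x\<^esub> loop_homotopy X x `` {q}
    = loop_homotopy X x `` {loop_concat p q}"
proof -
  have "loop_homotopy X x `` {loop_concat p' q'} = loop_homotopy X x `` {loop_concat p q}"
    if "p' \<in> loop_homotopy X x `` {p}" "q' \<in> loop_homotopy X x `` {q}" for p' q'
  proof (rule equiv_class_eq[OF equiv_loop_homotopy])
    have "path_homotopic X p' p" "path_homotopic X q' q" "p' \<in> loops X x" "q' \<in> loops X x"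
      using that by (auto simp: loop_homotopy_iff path_homotopic_sym)
    then show "(loop_concat p' q', loop_concat p q) \<in> loop_homotopy X x"
      using p q unfolding loop_homotopy_iff
      by (intro conjI concat_loop path_homotopic_concat) (auto simp: loops_def)
  qed
  moreover have "p \<in> loop_homotopy X x `` {p}" "q \<in> loop_homotopy X x `` {q}"
    using p q by (auto simp: loop_homotopy_iff loops_def path_homotopic_refl)
  ultimately have "(\<Union>p'\<in>loop_homotopy X x `` {p}. \<Union>q'\<in>loop_homotopy X x `` {q}.
      loop_homotopy X x `` {loop_concat p' q'}) = loop_homotopy X x `` {loop_concat p q}"
    by (intro UN_constant_eq ballI)
  then show ?thesis by (simp add: fundamental_group_def)
qed

text \<open>The group structure of \<open>G\<close> is transported through the isomorphism, so only the multiplication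
  of \<open>fundamental_group X x\<close> is computed here: the class of the constant loop is its unit because it is
  idempotent, and the classes of \<open>T\<close> generate already as a monoid.\<close>
lemma finitely_generated_if_K_G_1:
  fixes G (structure)
  assumes G: "group G" and K: "is_K_G_1 G X" and comp: "compact_space X" and haus: "Hausdorff_space X"
    and loc: "locally_path_simple X"
  obtains S where "finite S" "S \<subseteq> carrier G" "generate G S = carrier G"
proof -
  interpret group G by (rule G)
  obtain x where x: "x \<in> topspace X" and "G \<cong> fundamental_group X x"
    using K by (auto simp: is_K_G_1_def)
  then obtain h where "h \<in> iso G (fundamental_group X x)"
    by (auto simp: is_iso_def)
  then have hom: "\<And>a b. \<lbrakk>a \<in> carrier G; b \<in> carrier G\<rbrakk> \<Longrightarrow>
      h (a \<otimes> b) = h a \<otimes>\<^bsub>fundamental_group X x\<^esub> h b"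
    and bij: "bij_betw h (carrier G) (loops X x // loop_homotopy X x)"
    by (auto simp: iso_def hom_def fundamental_group_def)
  let ?c = "\<lambda>p. loop_homotopy X x `` {p}"
  define k where "k p = inv_into (carrier G) h (?c p)" for p
  have k: "k p \<in> carrier G" "h (k p) = ?c p" if "p \<in> loops X x" for p
  proof -
    have "?c p \<in> h ` carrier G"
      using bij that by (simp add: bij_betw_def quotientI)
    then show "k p \<in> carrier G" "h (k p) = ?c p"
      unfolding k_def by (rule inv_into_into, rule f_inv_into_f)
  qed
  have inj: "a = b" if "h a = h b" "a \<in> carrier G" "b \<in> carrier G" for a b
    using bij that by (auto simp: bij_betw_def inj_on_def)
  have kmult: "k (loop_concat p q) = k p \<otimes> k q" if "p \<in> loops X x" "q \<in> loops X x" for p q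
    using that by (intro inj) (simp_all add: k hom concat_loop fundamental_group_mult)
  obtain T where T: "finite T" "T \<subseteq> loops X x"
    "\<And>p. p \<in> loops X x \<Longrightarrow> \<exists>w\<in>loop_words x T. path_homotopic X p w"
    using finitely_many_loops_generate[OF comp haus _ loc x] K by (auto simp: is_K_G_1_def)
  have words: "k w \<in> generate G (k ` T)" if "w \<in> loop_words x T" for w
    using that
  proof induction
    case const
    have c: "(\<lambda>_. x) \<in> loops X x" using x by (rule const_loop)
    have "loop_concat (\<lambda>_. x) (\<lambda>_. x) = (\<lambda>_. x)" by (auto simp: loop_concat_def)
    then have "k (\<lambda>_. x) \<otimes> k (\<lambda>_. x) = k (\<lambda>_. x)"
      using kmult[OF c c] by simp
    then have "k (\<lambda>_. x) = \<one>" using k(1)[OF c] by simp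
    then show ?case by (simp add: generate.one)
  next
    case (concat w p)
    then have "w \<in> loops X x" "p \<in> loops X x"
      using loop_words_subset_loops[OF x T(2)] T(2) by auto
    then have "k (loop_concat w p) = k w \<otimes> k p" by (rule kmult)
    then show ?case
      using concat by (auto intro: generate.eng generate.incl)
  qed
  have kT: "k ` T \<subseteq> carrier G" using k T(2) by auto
  have "carrier G \<subseteq> generate G (k ` T)"
  proof
    fix a assume a: "a \<in> carrier G"
    then have "h a \<in> loops X x // loop_homotopy X x"
      using bij by (auto simp: bij_betw_def)
    then obtain p where p: "p \<in> loops X x" "h a = ?c p"
      by (rule quotientE)
    obtain w where w: "w \<in> loop_words x T" "path_homotopic X p w"
      using T(3)[OF p(1)] by blast
    have wL: "w \<in> loops X x" using w(1) loop_words_subset_loops[OF x T(2)] by blast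
    have "?c p = ?c w"
      using p w wL by (intro equiv_class_eq[OF equiv_loop_homotopy]) (simp add: loop_homotopy_iff)
    then have "a = k w"
      using a p k[OF wL] by (intro inj) auto
    then show "a \<in> generate G (k ` T)" using words[OF w(1)] by simp
  qed
  then have "generate G (k ` T) = carrier G"
    using generate_incl[OF kT] by blast
  then show thesis using that[of "k ` T"] T(1) kT by blast
qed


section \<open>Vanishing of the rank gradient\<close>

theorem corollary1p2:
  fixes \<Gamma> :: "('a, 'b) monoid_scheme"
    and n :: nat
    and M :: "'x topology"
    and ori :: "'x \<Rightarrow> 'x chain set"
  assumes "group \<Gamma>"
    and "residually_finite \<Gamma>"
    and "infinite (carrier \<Gamma>)"
    and "amenable \<Gamma>"
    and "oriented_closed_connected_manifold n M ori"
    and "is_K_G_1 \<Gamma> M"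
  shows "rank_gradient \<Gamma> = 0"
proof -
  have "compact_space M" "Hausdorff_space M" "locally_path_simple M"
    using assms(5) locally_euclidean_imp_locally_path_simple
    by (auto simp: oriented_closed_connected_manifold_def manifold_def)
  then obtain S where "finite S" "S \<subseteq> carrier \<Gamma>" "generate \<Gamma> S = carrier \<Gamma>"
    using finitely_generated_if_K_G_1[OF assms(1,6)] by blast
  then show ?thesis
    using group.rank_gradient_zero[OF assms(1,4,2,3)] by blast
qed

end
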